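(* For all integers $k\ge 5$, $$\operatorname{ex}_{\mathcal P}(n,C_k,\{C_4\})=\Theta\big(n^{\lfloor k/3\rfloor}\big)\qquad (n\to\infty),$$ where the implied constants may depend on $k$.
   Context: All graphs are finite and simple. $C_t$ denotes the cycle on $t$ vertices. $\operatorname{ex}_{\mathcal P}(n,H,\{F\})$ denotes the maximum number of copies of $H$ (subgraphs isomorphic to $H$, not necessarily induced) in an $n$-vertex planar graph that does not contain $F$ as a subgraph (not necessarily induced). The notation $g(n)=\Theta(n^m)$ means that there are constants $c,C>0$ with $c\,n^m\le g(n)\le C\,n^m$ for all sufficiently large $n$. *)

theory Defs
  imports "HOL-Analysis.Analysis" "HOL-Library.Landau_Symbols"
begin

type_synonym 'a ugraph = "'a set \<times> 'a set set"

abbreviation verts :: "'a ugraph \<Rightarrow> 'a set" where "verts G \<equiv> fst G"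

abbreviation edges :: "'a ugraph \<Rightarrow> 'a set set" where "edges G \<equiv> snd G"

definition simple_graph :: "'a ugraph \<Rightarrow> bool" where
  "simple_graph G \<longleftrightarrow> finite (verts G) \<and> (\<forall>e\<in>edges G. e \<subseteq> verts G \<and> card e = 2)"

definition subgraph :: "'a ugraph \<Rightarrow> 'a ugraph \<Rightarrow> bool" where
  "subgraph S G \<longleftrightarrow> simple_graph S \<and> verts S \<subseteq> verts G \<and> edges S \<subseteq> edges G"

definition graph_iso :: "'a ugraph \<Rightarrow> 'b ugraph \<Rightarrow> bool" where
  "graph_iso G H \<longleftrightarrow> (\<exists>f. bij_betw f (verts G) (verts H) \<and> (\<lambda>e. f ` e) ` edges G = edges H)"

text \<open>A copy of \<open>H\<close> in \<open>G\<close> is a subgraph, i.e. a vertex set together with an edge set, and not an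
  embedding; hence the automorphisms of \<open>H\<close> do not contribute to the count.\<close>

definition copies :: "'a ugraph \<Rightarrow> 'b ugraph \<Rightarrow> 'b ugraph set" where
  "copies H G = {S. subgraph S G \<and> graph_iso H S}"

definition contains :: "'b ugraph \<Rightarrow> 'a ugraph \<Rightarrow> bool" where
  "contains G H \<longleftrightarrow> copies H G \<noteq> {}"

text \<open>Meaningful as a cycle only for \<open>t \<ge> 3\<close>.\<close>

definition cycle_graph :: "nat \<Rightarrow> nat ugraph" where
  "cycle_graph t = ({..<t}, {{i, (i + 1) mod t} | i. i < t})"

text \<open>A drawing in the plane, which is identified with the complex numbers: \<open>p\<close> places the
  vertices, and \<open>\<gamma> e\<close> is a simple arc joining the two ends of the edge \<open>e\<close>. An arc meets no vertices
  except its ends, and two distinct arcs meet at most in the common end of their edges.\<close>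

definition plane_drawing :: "'a ugraph \<Rightarrow> ('a \<Rightarrow> complex) \<Rightarrow> ('a set \<Rightarrow> real \<Rightarrow> complex) \<Rightarrow> bool" where
  "plane_drawing G p \<gamma> \<longleftrightarrow>
     inj_on p (verts G) \<and>
     (\<forall>e\<in>edges G. arc (\<gamma> e) \<and> {pathstart (\<gamma> e), pathfinish (\<gamma> e)} = p ` e \<and>
        path_image (\<gamma> e) \<inter> p ` verts G = p ` e) \<and>
     (\<forall>e\<in>edges G. \<forall>e'\<in>edges G. e \<noteq> e' \<longrightarrow>
        path_image (\<gamma> e) \<inter> path_image (\<gamma> e') \<subseteq> p ` (e \<inter> e'))"

definition planar :: "'a ugraph \<Rightarrow> bool" where
  "planar G \<longleftrightarrow> (\<exists>p \<gamma>. plane_drawing G p \<gamma>)"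

definition planar_free_graphs :: "nat \<Rightarrow> 'f ugraph set \<Rightarrow> nat ugraph set" where
  "planar_free_graphs n \<F> =
     {G. simple_graph G \<and> card (verts G) = n \<and> planar G \<and> (\<forall>F\<in>\<F>. \<not> contains G F)}"

text \<open>Every finite graph is isomorphic to one whose vertices are natural numbers, so it suffices to
  maximise over these. The two lemmas below show that the maximum is over a finite set, which is
  nonempty if every forbidden graph has an edge.\<close>

definition ex_planar :: "nat \<Rightarrow> 'h ugraph \<Rightarrow> 'f ugraph set \<Rightarrow> nat" where
  "ex_planar n H \<F> = Max ((\<lambda>G. card (copies H G)) ` planar_free_graphs n \<F>)"

lemma finite_copies_counts:
  "finite ((\<lambda>G. card (copies H G)) ` planar_free_graphs n \<F>)"
proof -
  have "card (copies H G) \<le> 2 ^ n * 2 ^ 2 ^ n" if "G \<in> planar_free_graphs n \<F>" for G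
  proof -
    let ?A = "Pow (verts G) \<times> Pow (Pow (verts G))"
    have G: "finite (verts G)" "card (verts G) = n"
      using that by (auto simp: planar_free_graphs_def simple_graph_def)
    have "copies H G \<subseteq> ?A"
    proof
      fix S assume "S \<in> copies H G"
      then have "verts S \<subseteq> verts G" "\<forall>e\<in>edges S. e \<subseteq> verts S"
        by (simp_all add: copies_def subgraph_def simple_graph_def)
      then show "S \<in> ?A" by (cases S) auto
    qed
    moreover have "finite ?A" using G by simp
    ultimately have "card (copies H G) \<le> card ?A" by (intro card_mono)
    also have "\<dots> = 2 ^ n * 2 ^ 2 ^ n" using G by (simp add: card_cartesian_product card_Pow)
    finally show ?thesis .
  qed
  then show ?thesis
    unfolding finite_nat_set_iff_bounded_le by blast
qed

lemma planar_free_graphs_nonempty: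
  assumes "\<And>F. F \<in> \<F> \<Longrightarrow> edges F \<noteq> {}"
  shows "planar_free_graphs n \<F> \<noteq> {}"
proof -
  have "plane_drawing ({..<n}, {}) (of_nat :: nat \<Rightarrow> complex) \<gamma>" for \<gamma>
    by (auto simp: plane_drawing_def inj_on_def)
  then have "planar ({..<n}, {})"
    unfolding planar_def by blast
  moreover have "\<not> contains ({..<n}, {}) F" if "F \<in> \<F>" for F
    using assms[OF that] by (auto simp: contains_def copies_def subgraph_def graph_iso_def)
  ultimately have "({..<n}, {}) \<in> planar_free_graphs n \<F>"
    by (simp add: planar_free_graphs_def simple_graph_def)
  then show ?thesis by blast
qed

end

theory Submission
  imports Defs
begin

text \<open>
  Upper bound. Every finite plane graph has an orientation of bounded outdegree (see below), so each
  copy of \<open>C\<^sub>k\<close> inherits an orientation. Vertices of the copy can be recovered from fewer of them in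
  two ways: an out-neighbour of a known vertex is one of boundedly many, and a vertex whose two
  neighbours on the cycle are known is determined, since there is no \<open>C\<^sub>4\<close>. Whatever the
  orientation of the cycle is, \<open>k div 3\<close> vertices suffice to recover it: one vertex gives two
  consecutive vertices always, three if the middle one is not a sink, four if neither of the middle
  ones is a sink, and one vertex may be skipped between consecutive groups.

  The orientation comes from a linear bound on the number of edges. Dense graphs have a \<open>K\<^sub>6\<close> minor
  (Mader), hence a \<open>K\<^bsub>3,3\<^esub>\<close> minor. Two of its branch sets on one side, joined through the three
  on the other side, yield three arcs between two points; by Janiszewski's theorem each face of this
  theta curve is bounded by two of the arcs only, whereas the remaining branch set reaches the
  interior of all three.

  Lower bound. In a cycle of length \<open>k\<close>, replace \<open>k div 3\<close> disjoint subpaths of length 3 by about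
  \<open>n / k\<close> internally disjoint ones each.
\<close>

subsection \<open>The faces of a theta curve\<close>

text \<open>All constants may be crude, but the exponent has to be exactly \<open>k div 3\<close>;
  so a weak linear edge bound is enough on the topological side, while the encoding of a cycle is
  delicate. Any k - 1 consecutive positions determine the last one, and q pairs with single gaps
  cover 3q - 1 positions, so pairs alone suffice when 3 divides k. For the other residues one or two
  more positions must be gained without a further generator. Sinks are never consecutive, so a
  middle vertex that is not a sink always exists, which gains one position. Gaining two in a single
  group is impossible only if sinks and non-sinks alternate; then k is even, so k = 5 is excluded
  and there is room for two groups of three. In the lower bound the replaced subpaths need two inner
  vertices: two parallel paths of length two form a C_4, two of length three only a C_6.\<close>

lemma jordan_side_avoiding:
  fixes c1 c2 :: "real \<Rightarrow> complex"
  assumes c: "arc c1" "arc c2" "pathstart c1 = a" "pathstart c2 = a" "pathfinish c1 = b" "pathfinish c2 = b"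
    and int: "path_image c1 \<inter> path_image c2 = {a, b}"
    and K: "connected K" "K \<inter> (path_image c1 \<union> path_image c2) = {}" "K \<noteq> {}"
  shows "\<exists>E. connected E \<and> E \<noteq> {} \<and> E \<inter> (path_image c1 \<union> path_image c2) = {} \<and> E \<inter> K = {} \<and>
    frontier E = path_image c1 \<union> path_image c2 \<and>
    (\<forall>x y. x \<notin> E \<union> path_image c1 \<union> path_image c2 \<longrightarrow> y \<notin> E \<union> path_image c1 \<union> path_image c2 \<longrightarrow>
       connected_component (- (path_image c1 \<union> path_image c2)) x y)"
proof -
  define g where "g = c1 +++ reversepath c2"
  have pg: "path_image g = path_image c1 \<union> path_image c2"
    using c by (simp add: g_def path_image_join)
  have "simple_path g"
    unfolding g_def using c int by (intro simple_path_join_loop) (auto simp: arc_reversepath)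
  moreover have "pathfinish g = pathstart g"
    using c by (simp add: g_def)
  ultimately have J: "inside (path_image g) \<noteq> {}" "connected (inside (path_image g))"
      "open (inside (path_image g))" "open (outside (path_image g))"
      "outside (path_image g) \<noteq> {}" "connected (outside (path_image g))"
      "inside (path_image g) \<inter> outside (path_image g) = {}"
      "inside (path_image g) \<union> outside (path_image g) = - path_image g"
      "frontier (inside (path_image g)) = path_image g"
      "frontier (outside (path_image g)) = path_image g"
    using Jordan_inside_outside[of g] by auto
  \<comment> \<open>\<open>E\<close> is the side of the Jordan curve away from \<open>K\<close> and
    \<open>D\<close> the other one. Connectedness of \<open>D\<close> yields the last clause, in the
    shape that Janiszewski's theorem asks for.\<close>
  have side: ?thesis
    if E: "E \<inter> K = {}" "connected E" "connected D" "E \<noteq> {}" "E \<inter> D = {}" "E \<union> D = - path_image g"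
      "frontier E = path_image g" for E D
  proof -
    have "connected_component (- (path_image c1 \<union> path_image c2)) x y"
      if "x \<notin> E \<union> path_image c1 \<union> path_image c2" "y \<notin> E \<union> path_image c1 \<union> path_image c2" for x y
      unfolding connected_component_def
      using that E pg by (intro exI[of _ D]) auto
    moreover have "E \<inter> (path_image c1 \<union> path_image c2) = {}"
      using E pg by auto
    ultimately show ?thesis
      using E pg by (intro exI[of _ E]) simp
  qed
  have "K \<inter> inside (path_image g) = {} \<or> K \<inter> outside (path_image g) = {}"
  proof (rule ccontr)
    assume "\<not> ?thesis"
    moreover have "K \<subseteq> inside (path_image g) \<union> outside (path_image g)"
      using K(2) J(8) pg by auto
    moreover have "inside (path_image g) \<inter> outside (path_image g) \<inter> K = {}"
      using J(7) by auto
    ultimately show False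
      using connectedD[OF K(1) J(3,4)] by (metis Int_commute)
  qed
  then show ?thesis
  proof
    assume "K \<inter> inside (path_image g) = {}"
    then show ?thesis
      using J by (intro side[of "inside (path_image g)" "outside (path_image g)"]) (simp_all only: Int_commute not_False_eq_True)
  next
    assume "K \<inter> outside (path_image g) = {}"
    then show ?thesis
      using J by (intro side[of "outside (path_image g)" "inside (path_image g)"]) (simp_all only: Int_commute Un_commute not_False_eq_True)
  qed
qed

text \<open>A theta curve has only three faces: for each two of the arcs, the side of their Jordan
  curve away from the third. A fourth face \<open>W\<close> would be separated from
  \<open>E23\<close> neither by \<open>c1\<close> with \<open>c2\<close> nor by \<open>c1\<close>
  with \<open>c3\<close>; these two curves meet in the connected set \<open>path_image c1\<close>,
  so by Janiszewski's theorem their union does not separate \<open>W\<close> from \<open>E23\<close>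
  either.\<close>

lemma theta_face:
  fixes c1 c2 c3 :: "real \<Rightarrow> complex"
  assumes arcs: "arc c1" "arc c2" "arc c3"
    and ends: "pathstart c1 = a" "pathstart c2 = a" "pathstart c3 = a"
      "pathfinish c1 = b" "pathfinish c2 = b" "pathfinish c3 = b"
    and int: "path_image c1 \<inter> path_image c2 = {a, b}" "path_image c1 \<inter> path_image c3 = {a, b}"
      "path_image c2 \<inter> path_image c3 = {a, b}"
    and W: "W \<in> components (- (path_image c1 \<union> path_image c2 \<union> path_image c3))"
  shows "\<exists>c\<in>{c1, c2, c3}. frontier W \<inter> (path_image c - {a, b}) = {}"
proof -
  let ?T = "path_image c1 \<union> path_image c2 \<union> path_image c3"
  have K: "connected (path_image c - {a, b})" "path_image c - {a, b} \<noteq> {}" if "c \<in> {c1, c2, c3}" for c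
    using that arcs ends connected_simple_path_endless[of c] nonempty_simple_path_endless[of c]
    by (auto simp: arc_imp_simple_path)
  have d3: "(path_image c3 - {a, b}) \<inter> (path_image c1 \<union> path_image c2) = {}"
    using int by auto
  obtain E12 where E12: "connected E12" "E12 \<noteq> {}" "E12 \<inter> (path_image c1 \<union> path_image c2) = {}"
      "E12 \<inter> (path_image c3 - {a, b}) = {}" "frontier E12 = path_image c1 \<union> path_image c2"
      "\<forall>p q. p \<notin> E12 \<union> path_image c1 \<union> path_image c2 \<longrightarrow> q \<notin> E12 \<union> path_image c1 \<union> path_image c2 \<longrightarrow>
         connected_component (- (path_image c1 \<union> path_image c2)) p q"
    using jordan_side_avoiding[OF arcs(1) arcs(2) ends(1) ends(2) ends(4) ends(5) int(1) K(1)[of c3] d3 K(2)[of c3]]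
    by auto
  have d2: "(path_image c2 - {a, b}) \<inter> (path_image c1 \<union> path_image c3) = {}"
    using int by auto
  obtain E13 where E13: "connected E13" "E13 \<noteq> {}" "E13 \<inter> (path_image c1 \<union> path_image c3) = {}"
      "E13 \<inter> (path_image c2 - {a, b}) = {}" "frontier E13 = path_image c1 \<union> path_image c3"
      "\<forall>p q. p \<notin> E13 \<union> path_image c1 \<union> path_image c3 \<longrightarrow> q \<notin> E13 \<union> path_image c1 \<union> path_image c3 \<longrightarrow>
         connected_component (- (path_image c1 \<union> path_image c3)) p q"
    using jordan_side_avoiding[OF arcs(1) arcs(3) ends(1) ends(3) ends(4) ends(6) int(2) K(1)[of c2] d2 K(2)[of c2]]
    by auto
  have d1: "(path_image c1 - {a, b}) \<inter> (path_image c2 \<union> path_image c3) = {}"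
    using int by auto
  obtain E23 where E23: "connected E23" "E23 \<noteq> {}" "E23 \<inter> (path_image c2 \<union> path_image c3) = {}"
      "E23 \<inter> (path_image c1 - {a, b}) = {}" "frontier E23 = path_image c2 \<union> path_image c3"
      "\<forall>p q. p \<notin> E23 \<union> path_image c2 \<union> path_image c3 \<longrightarrow> q \<notin> E23 \<union> path_image c2 \<union> path_image c3 \<longrightarrow>
         connected_component (- (path_image c2 \<union> path_image c3)) p q"
    using jordan_side_avoiding[OF arcs(2) arcs(3) ends(2) ends(3) ends(5) ends(6) int(3) K(1)[of c1] d1 K(2)[of c1]]
    by auto
  have ab: "a \<in> path_image c1 \<inter> path_image c2 \<inter> path_image c3" "b \<in> path_image c1 \<inter> path_image c2 \<inter> path_image c3"
    using int by auto
  have disj: "E12 \<inter> ?T = {}" "E13 \<inter> ?T = {}" "E23 \<inter> ?T = {}"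
    using E12(3,4) E13(3,4) E23(3,4) ab by auto
  \<comment> \<open>A connected set off the curve whose frontier lies on the curve cannot be a
    proper part of a component, which would have to cross that frontier.\<close>
  have face: "E = V"
    if "connected E" "E \<inter> ?T = {}" "frontier E \<subseteq> ?T" "V \<in> components (- ?T)" "E \<inter> V \<noteq> {}" for E V
  proof
    show "E \<subseteq> V"
      using components_maximal[OF that(4,1)] that by blast
    have "V \<inter> frontier E = {}" "connected V"
      using that in_components_connected in_components_subset by blast+
    then show "V \<subseteq> E"
      using connected_Int_frontier[of V E] that by auto
  qed
  have comp: "E \<in> components (- ?T)"
    if "connected E" "E \<noteq> {}" "E \<inter> ?T = {}" "frontier E \<subseteq> ?T" for E
  proof -
    have "E \<subseteq> - ?T" "- ?T \<noteq> {}"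
      using that by blast+
    then have "\<exists>V. V \<in> components (- ?T) \<and> E \<subseteq> V"
      using that(1) by (rule exists_component_superset)
    then obtain V where "V \<in> components (- ?T)" "E \<subseteq> V"
      by blast
    with face[of E V] that show ?thesis by auto
  qed
  have comps: "E12 \<in> components (- ?T)" "E13 \<in> components (- ?T)" "E23 \<in> components (- ?T)"
    using comp[OF E12(1,2) disj(1)] comp[OF E13(1,2) disj(2)] comp[OF E23(1,2) disj(3)] E12(5) E13(5) E23(5)
    by auto
  \<comment> \<open>An inner point of \<open>c1\<close> is on the frontiers of \<open>E12\<close>
    and \<open>E13\<close> but not on that of \<open>E23\<close>, so \<open>E23\<close> is a
    different component and disjoint from both.\<close>
  obtain x where x: "x \<in> path_image c1 - {a, b}"
    using K(2)[of c1] by auto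
  then have "x \<in> frontier E12" "x \<in> frontier E13"
    unfolding E12(5) E13(5) by simp_all
  moreover have "x \<notin> frontier E23"
    unfolding E23(5) using x d1 by auto
  ultimately have "E12 \<noteq> E23" "E13 \<noteq> E23"
    by auto
  then have dd: "E12 \<inter> E23 = {}" "E13 \<inter> E23 = {}"
    using comps components_nonoverlap by blast+
  have "W = E12 \<or> W = E13 \<or> W = E23"
  proof (rule ccontr)
    assume "\<not> ?thesis"
    then have n: "W \<noteq> E12" "W \<noteq> E13" "W \<noteq> E23" by auto
    then have dw: "E12 \<inter> W = {}" "E13 \<inter> W = {}" "E23 \<inter> W = {}"
      using comps W components_nonoverlap by blast+
    obtain w where w: "w \<in> W" using W in_components_nonempty by blast
    obtain e where e: "e \<in> E23" using E23 by blast
    have wT: "w \<notin> ?T" using W w in_components_subset by blast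
    have "connected_component (- ((path_image c1 \<union> path_image c2) \<union> (path_image c1 \<union> path_image c3))) w e"
    proof (rule Janiszewski)
      show "compact (path_image c1 \<union> path_image c2)" "closed (path_image c1 \<union> path_image c3)"
        using arcs by (auto intro!: compact_Un closed_Un simp: compact_arc_image closed_arc_image)
      have "(path_image c1 \<union> path_image c2) \<inter> (path_image c1 \<union> path_image c3) = path_image c1"
        using int by auto
      then show "connected ((path_image c1 \<union> path_image c2) \<inter> (path_image c1 \<union> path_image c3))"
        using arcs by (simp add: connected_arc_image)
      show "connected_component (- (path_image c1 \<union> path_image c2)) w e"
        using w e dw dd wT disj by (intro E12(6)[rule_format]) auto
      show "connected_component (- (path_image c1 \<union> path_image c3)) w e"
        using w e dw dd wT disj by (intro E13(6)[rule_format]) auto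
    qed
    then have "connected_component (- ?T) w e"
      by (simp add: Un_ac)
    moreover obtain z where "W = connected_component_set (- ?T) z"
      using W by (auto elim: componentsE)
    ultimately have "e \<in> W"
      using w connected_component_trans by fastforce
    with e dw show False by blast
  qed
  moreover have "frontier E12 \<inter> (path_image c3 - {a, b}) = {}"
    unfolding E12(5) using d3 by (simp add: Int_commute)
  moreover have "frontier E13 \<inter> (path_image c2 - {a, b}) = {}"
    unfolding E13(5) using d2 by (simp add: Int_commute)
  moreover have "frontier E23 \<inter> (path_image c1 - {a, b}) = {}"
    unfolding E23(5) using d1 by (simp add: Int_commute)
  ultimately show ?thesis
    by (elim disjE) simp_all
qed

text \<open>\<open>Z i\<close> leads from \<open>y\<close> to the arc \<open>c i\<close> and touches
  no other arc. By \<open>theta_face\<close>, the frontier of the face of \<open>y\<close> misses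
  the inner points of some \<open>c i\<close>. But \<open>Z i\<close> has to leave this face through
  its frontier, hence at a point of \<open>c i\<close>, and neither \<open>a\<close> nor
  \<open>b\<close> is in \<open>Z i\<close>.\<close>

lemma theta_no_common_neighbour:
  fixes c :: "nat \<Rightarrow> real \<Rightarrow> complex"
  assumes c: "\<And>i. i < 3 \<Longrightarrow> arc (c i) \<and> pathstart (c i) = a \<and> pathfinish (c i) = b"
    and int: "\<And>i j. i < 3 \<Longrightarrow> j < 3 \<Longrightarrow> i \<noteq> j \<Longrightarrow> path_image (c i) \<inter> path_image (c j) \<subseteq> {a, b}"
    and Z: "\<And>i. i < 3 \<Longrightarrow> connected (Z i) \<and> y \<in> Z i \<and> a \<notin> Z i \<and> b \<notin> Z i"
    and meet: "\<And>i. i < 3 \<Longrightarrow> Z i \<inter> path_image (c i) \<noteq> {}"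
    and avoid: "\<And>i j. i < 3 \<Longrightarrow> j < 3 \<Longrightarrow> i \<noteq> j \<Longrightarrow> Z i \<inter> path_image (c j) = {}"
  shows False
proof -
  let ?T = "path_image (c 0) \<union> path_image (c 1) \<union> path_image (c 2)"
  have T: "x \<in> ?T \<longleftrightarrow> (\<exists>i<3. x \<in> path_image (c i))" for x
    by (auto simp: numeral_3_eq_3 less_Suc_eq numeral_2_eq_2)
  have yT: "y \<notin> ?T"
  proof
    assume "y \<in> ?T"
    then obtain i where i: "i < 3" "y \<in> path_image (c i)" using T by blast
    obtain j :: nat where "j < 3" "j \<noteq> i" by (metis numeral_3_eq_3 zero_less_Suc lessI less_numeral_extra(3) zero_neq_numeral not_less_eq less_Suc_eq)
    with i Z[of j] avoid[of j i] show False by auto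
  qed
  have ab: "a \<in> path_image (c i)" "b \<in> path_image (c i)" if "i < 3" for i
    using c[OF that] pathstart_in_path_image pathfinish_in_path_image by metis+
  have int': "path_image (c i) \<inter> path_image (c j) = {a, b}" if "i < 3" "j < 3" "i \<noteq> j" for i j
    using int[OF that] ab[OF that(1)] ab[OF that(2)] by auto
  define W where "W = connected_component_set (- ?T) y"
  have W: "W \<in> components (- ?T)" "y \<in> W"
    using yT by (auto simp: W_def components_def)
  have "\<exists>c'\<in>{c 0, c 1, c 2}. frontier W \<inter> (path_image c' - {a, b}) = {}"
    by (rule theta_face[OF _ _ _ _ _ _ _ _ _ _ _ _ W(1)]) (use c int' in auto)
  then obtain i where i: "i < 3" "frontier W \<inter> (path_image (c i) - {a, b}) = {}"
    by (auto simp: numeral_3_eq_3 numeral_2_eq_2)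
  have "closed ?T"
    using c by (intro closed_Un closed_arc_image) auto
  then have fr: "frontier W \<subseteq> ?T"
    using frontier_of_components_subset[OF W(1)] frontier_complement frontier_subset_eq
    by (metis order_trans)
  have "frontier W \<inter> Z i = {}"
  proof -
    have "x \<in> path_image (c i) - {a, b}" if "x \<in> frontier W" "x \<in> Z i" for x
    proof -
      have "x \<in> ?T" using fr that(1) by blast
      then obtain j where "j < 3" "x \<in> path_image (c j)" unfolding T by blast
      then show ?thesis using that avoid[of i j] i Z[of i] by (cases "i = j") auto
    qed
    then show ?thesis using i by blast
  qed
  moreover have "Z i \<inter> W \<noteq> {}" using W Z i by blast
  moreover have "Z i - W \<noteq> {}"
  proof -
    obtain x where "x \<in> Z i" "x \<in> path_image (c i)" using meet[OF i(1)] by blast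
    moreover from this have "x \<in> ?T" unfolding T using i by blast
    then have "x \<notin> W" using in_components_subset[OF W(1)] by blast
    ultimately show ?thesis by blast
  qed
  ultimately show False
    using connected_Int_frontier[of "Z i" W] Z[OF i(1)] by (simp add: Int_commute)
qed

subsection \<open>Clique minors in dense graphs\<close>

definition conn_in :: "('a \<Rightarrow> 'a \<Rightarrow> bool) \<Rightarrow> 'a set \<Rightarrow> bool" where
  "conn_in E X \<longleftrightarrow> X \<noteq> {} \<and> (\<forall>x\<in>X. \<forall>y\<in>X. (\<lambda>a b. E a b \<and> a \<in> X \<and> b \<in> X)\<^sup>*\<^sup>* x y)"

definition clique_minor :: "('a \<Rightarrow> 'a \<Rightarrow> bool) \<Rightarrow> 'a set \<Rightarrow> nat \<Rightarrow> (nat \<Rightarrow> 'a set) \<Rightarrow> bool" where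
  "clique_minor E V r X \<longleftrightarrow>
     (\<forall>i<r. conn_in E (X i) \<and> X i \<subseteq> V) \<and>
     (\<forall>i<r. \<forall>j<r. i \<noteq> j \<longrightarrow> X i \<inter> X j = {} \<and> (\<exists>x\<in>X i. \<exists>y\<in>X j. E x y))"

definition nbrs :: "('a \<Rightarrow> 'a \<Rightarrow> bool) \<Rightarrow> 'a set \<Rightarrow> 'a \<Rightarrow> 'a set" where
  "nbrs E V v = {w \<in> V. E v w}"

lemma conn_in_mono:
  assumes "conn_in E X" "\<And>a b. a \<in> X \<Longrightarrow> b \<in> X \<Longrightarrow> E a b \<Longrightarrow> E' a b"
  shows "conn_in E' X"
  unfolding conn_in_def
proof (intro conjI ballI)
  fix x y assume "x \<in> X" "y \<in> X"
  with assms(1) have "(\<lambda>a b. E a b \<and> a \<in> X \<and> b \<in> X)\<^sup>*\<^sup>* x y"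
    by (auto simp: conn_in_def)
  then show "(\<lambda>a b. E' a b \<and> a \<in> X \<and> b \<in> X)\<^sup>*\<^sup>* x y"
    by (rule rtranclp_mono[THEN predicate2D, rotated]) (use assms(2) in auto)
qed (use assms(1) in \<open>auto simp: conn_in_def\<close>)

lemma conn_in_via:
  assumes "v \<in> X" "symp E"
    and "\<And>x. x \<in> X \<Longrightarrow> (\<lambda>a b. E a b \<and> a \<in> X \<and> b \<in> X)\<^sup>*\<^sup>* x v"
  shows "conn_in E X"
  unfolding conn_in_def
proof (intro conjI ballI)
  have "symp (\<lambda>a b. E a b \<and> a \<in> X \<and> b \<in> X)"
    using assms(2) by (auto simp: symp_def)
  then have "symp (\<lambda>a b. E a b \<and> a \<in> X \<and> b \<in> X)\<^sup>*\<^sup>*"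
    by (rule symp_rtranclp)
  then show "(\<lambda>a b. E a b \<and> a \<in> X \<and> b \<in> X)\<^sup>*\<^sup>* x y" if "x \<in> X" "y \<in> X" for x y
    using assms(3)[OF that(1)] assms(3)[OF that(2)] by (meson rtranclp_trans sympD)
qed (use assms(1) in auto)

lemma conn_in_singleton: "conn_in E {v}"
  by (simp add: conn_in_def)

text \<open>\<open>E'\<close> arises by contracting \<open>v\<close> into \<open>u\<close>. A step
  at \<open>u\<close> that is inherited from \<open>v\<close> is replaced by a detour through
  \<open>v\<close>.\<close>

lemma conn_in_uncontract:
  assumes E: "symp E" "E u v" and X: "conn_in E' X" "u \<in> X" "v \<notin> X"
    and E': "\<And>a b. E' a b \<Longrightarrow> a \<noteq> v \<Longrightarrow> b \<noteq> v \<Longrightarrow> E a b \<or> (a = u \<and> E v b) \<or> (b = u \<and> E v a)"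
  shows "conn_in E (insert v X)"
proof (rule conn_in_via[of u])
  let ?R = "\<lambda>a b. E a b \<and> a \<in> insert v X \<and> b \<in> insert v X"
  have vu: "?R\<^sup>*\<^sup>* v u" "?R\<^sup>*\<^sup>* u v"
    using E X(2) by (auto dest: sympD)
  have step: "?R\<^sup>*\<^sup>* a b" if "E' a b \<and> a \<in> X \<and> b \<in> X" for a b
  proof -
    have "E a b \<or> (a = u \<and> E v b) \<or> (b = u \<and> E v a)"
      using E'[of a b] that X(3) by auto
    then show ?thesis
    proof (elim disjE conjE)
      assume "a = u" "E v b"
      then show ?thesis
        using vu(2) that by (auto intro: rtranclp.rtrancl_into_rtrancl)
    next
      assume "b = u" "E v a"
      then have "?R a v" using E(1) that by (auto dest: sympD)
      then show ?thesis
        using vu(1) unfolding \<open>b = u\<close> by (rule converse_rtranclp_into_rtranclp)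
    qed (use that in auto)
  qed
  show "?R\<^sup>*\<^sup>* x u" if "x \<in> insert v X" for x
  proof (cases "x = v")
    case False
    then have "(\<lambda>a b. E' a b \<and> a \<in> X \<and> b \<in> X)\<^sup>*\<^sup>* x u"
      using that X by (auto simp: conn_in_def)
    then show ?thesis
    proof (induction rule: rtranclp_induct)
      case (step y z)
      then show ?case using \<open>\<And>a b. E' a b \<and> a \<in> X \<and> b \<in> X \<Longrightarrow> ?R\<^sup>*\<^sup>* a b\<close>[of y z] by (meson rtranclp_trans)
    qed simp
  qed (use vu in simp)
qed (use X E in auto)

text \<open>Degree sums are counted as sets of ordered adjacent pairs, and \<open>f\<close> renames
  \<open>v\<close> to \<open>u\<close> in them. Outside \<open>D\<close> this is injective and
  yields pairs of the contracted graph: \<open>D\<close> holds the pairs at \<open>v\<close> that a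
  common neighbour would duplicate, two for each common neighbour, and the two pairs of the
  contracted edge.\<close>

lemma sum_nbrs_contract:
  assumes fin: "finite V" and E: "symp E" "irreflp E" and uv: "u \<in> V" "v \<in> V" "E u v"
    and E': "E' = (\<lambda>a b. a \<noteq> b \<and> (E a b \<or> (a = u \<and> E v b) \<or> (b = u \<and> E v a)))"
  shows "(\<Sum>w\<in>V. card (nbrs E V w)) \<le>
    (\<Sum>w\<in>V - {v}. card (nbrs E' (V - {v}) w)) + 2 * card (nbrs E V u \<inter> nbrs E V v) + 2"
proof -
  let ?C = "nbrs E V u \<inter> nbrs E V v"
  define P where "P = (SIGMA w:V. nbrs E V w)"
  define Q where "Q = (SIGMA w:V - {v}. nbrs E' (V - {v}) w)"
  have finN: "finite (nbrs F W w)" if "finite W" for F :: "'a \<Rightarrow> 'a \<Rightarrow> bool" and W w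
    using that by (simp add: nbrs_def)
  define f where "f = (\<lambda>(a, b). (if a = v then u else a, if b = v then u else b))"
  define D where "D = {v} \<times> ?C \<union> ?C \<times> {v} \<union> {(u, v), (v, u)}"
  have uv': "u \<noteq> v" using E uv by (auto simp: irreflp_def)
  have h1: "b \<noteq> u" "b \<noteq> v" "\<not> E u b" if "(v, b) \<in> P - D" for b
    using that E by (auto simp: P_def D_def nbrs_def irreflp_def)
  have h2: "a \<noteq> u" "a \<noteq> v" "\<not> E a u" if "(a, v) \<in> P - D" for a
    using that E by (auto simp: P_def D_def nbrs_def irreflp_def dest: sympD)
  have h3: "E a b" "a \<in> V" "b \<in> V" "a \<noteq> b" if "(a, b) \<in> P - D" for a b
    using that E by (auto simp: P_def D_def nbrs_def irreflp_def)
  have "inj_on f (P - D)"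
  proof (rule inj_onI)
    fix p q assume pq: "p \<in> P - D" "q \<in> P - D" "f p = f q"
    obtain a b a' b' where ab: "p = (a, b)" "q = (a', b')" by (cases p, cases q) auto
    note pq = pq[unfolded ab]
    have k: "b \<noteq> u \<and> b \<noteq> v \<and> \<not> E u b" if "a = v" using h1[OF pq(1)[unfolded that]] by simp
    have k': "a \<noteq> u \<and> a \<noteq> v \<and> \<not> E a u" if "b = v" using h2[OF pq(1)[unfolded that]] by simp
    have l: "b' \<noteq> u \<and> b' \<noteq> v \<and> \<not> E u b'" if "a' = v" using h1[OF pq(2)[unfolded that]] by simp
    have l': "a' \<noteq> u \<and> a' \<noteq> v \<and> \<not> E a' u" if "b' = v" using h2[OF pq(2)[unfolded that]] by simp
    have E2: "E a b" "E a' b'" using h3(1) pq(1,2) by simp_all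
    have "(if a = v then u else a) = (if a' = v then u else a')" "(if b = v then u else b) = (if b' = v then u else b')"
      using pq(3) by (simp_all add: f_def)
    then show "p = q"
      unfolding ab using k k' l l' E2 by (cases "a = v"; cases "b = v"; cases "a' = v"; cases "b' = v") auto
  qed
  moreover have "f ` (P - D) \<subseteq> Q"
  proof
    fix q assume "q \<in> f ` (P - D)"
    then obtain a b where ab: "(a, b) \<in> P - D" "q = f (a, b)" by (metis imageE surj_pair)
    have k: "b \<noteq> u \<and> b \<noteq> v \<and> E v b" if "a = v" using h1(1,2) h3(1) ab(1) that by simp
    have k': "a \<noteq> u \<and> a \<noteq> v \<and> E v a" if "b = v" using h2(1,2) h3(1) ab(1) E(1) that by (simp add: sympD)
    show "q \<in> Q"
      unfolding ab(2) using k k' h3[OF ab(1)] uv(1) uv'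
      by (cases "a = v"; cases "b = v") (auto simp: Q_def nbrs_def E' f_def)
  qed
  moreover have "finite Q" unfolding Q_def using fin finN by blast
  ultimately have "card (P - D) \<le> card Q"
    by (meson card_inj_on_le)
  moreover have "card P \<le> card (P - D) + card D"
  proof -
    have "finite D" unfolding D_def using finN[OF fin] by auto
    then have "card (P \<union> D) \<le> card (P - D) + card D"
      by (metis Un_Diff_cancel2 card_Un_le)
    moreover have "card P \<le> card (P \<union> D)"
      using fin finN[OF fin] \<open>finite D\<close> by (intro card_mono) (auto simp: P_def)
    ultimately show ?thesis by linarith
  qed
  moreover have "card D \<le> 2 * card ?C + 2"
  proof -
    have "card D \<le> card ({v} \<times> ?C) + card (?C \<times> {v}) + card {(u, v), (v, u)}"
      unfolding D_def using card_Un_le[of "{v} \<times> ?C \<union> ?C \<times> {v}" "{(u, v), (v, u)}"] card_Un_le[of "{v} \<times> ?C" "?C \<times> {v}"]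
      by linarith
    moreover have "card {(u, v), (v, u)} \<le> 2"
      using card_length[of "[(u, v), (v, u)]"] by simp
    moreover have "card ({v} \<times> ?C) = card ?C" "card (?C \<times> {v}) = card ?C"
      unfolding card_cartesian_product by simp_all
    ultimately show ?thesis
      by linarith
  qed
  moreover have "card P = (\<Sum>w\<in>V. card (nbrs E V w))"
    unfolding P_def using fin finN by (intro card_SigmaI) auto
  moreover have "card Q = (\<Sum>w\<in>V - {v}. card (nbrs E' (V - {v}) w))"
    unfolding Q_def using fin finN by (intro card_SigmaI) auto
  ultimately show ?thesis by linarith
qed

lemma clique_minor_uncontract:
  assumes E: "symp E" "E u v" and uv: "u \<in> V" "v \<in> V" "u \<noteq> v"
    and E': "E' = (\<lambda>a b. a \<noteq> b \<and> (E a b \<or> (a = u \<and> E v b) \<or> (b = u \<and> E v a)))"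
    and X: "clique_minor E' (V - {v}) r X"
  shows "clique_minor E V r (\<lambda>i. if u \<in> X i then insert v (X i) else X i)"
  unfolding clique_minor_def
proof (intro conjI allI impI)
  let ?Y = "\<lambda>i. if u \<in> X i then insert v (X i) else X i"
  have c: "conn_in E' (X i)" "X i \<subseteq> V" "v \<notin> X i" if "i < r" for i
    using X that by (auto simp: clique_minor_def)
  show "conn_in E (?Y i)" if "i < r" for i
  proof (cases "u \<in> X i")
    case True
    then show ?thesis
      using conn_in_uncontract[OF E c(1)[OF that] True c(3)[OF that]] E' by simp
  next
    case False
    have "conn_in E (X i)"
      by (rule conn_in_mono[OF c(1)[OF that]]) (use False E' in auto)
    with False show ?thesis by simp
  qed
  show "?Y i \<subseteq> V" if "i < r" for i
    using c(2)[OF that] uv by auto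
  fix i j assume ij: "i < r" "j < r" "i \<noteq> j"
  then have d: "X i \<inter> X j = {}" "\<exists>x\<in>X i. \<exists>y\<in>X j. E' x y"
    using X by (auto simp: clique_minor_def)
  show "?Y i \<inter> ?Y j = {}"
    using d(1) c(3)[OF ij(1)] c(3)[OF ij(2)] by auto
  obtain x y where xy: "x \<in> X i" "y \<in> X j" "E' x y" using d by blast
  then have "E x y \<or> (x = u \<and> E v y) \<or> (y = u \<and> E v x)"
    by (simp add: E')
  then show "\<exists>x\<in>?Y i. \<exists>y\<in>?Y j. E x y"
    using xy E(1) by (metis insertI1 insertI2 sympD)
qed

text \<open>Mader's argument: an edge with few common neighbours can be contracted without lowering the
  density below the bound; if there is none, the neighbourhood of a vertex is dense.\<close>

lemma dense_imp_clique_minor: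
  assumes "finite V" "V \<noteq> {}" "symp E" "irreflp E"
    and "(\<Sum>w\<in>V. card (nbrs E V w)) \<ge> 4 ^ r * card V"
  shows "\<exists>X. clique_minor E V r X"
  using assms
proof (induction r arbitrary: V E)
  case 0
  then show ?case by (simp add: clique_minor_def)
next
  case (Suc r)
  from Suc.prems show ?case
  proof (induction "card V" arbitrary: V E rule: less_induct)
    case less
    note fin = less.prems(1) and E = less.prems(3,4)
    have finN: "finite (nbrs E V w)" for w
      using fin by (simp add: nbrs_def)
    show ?case
    proof (cases "\<exists>u\<in>V. \<exists>v\<in>V. E u v \<and> card (nbrs E V u \<inter> nbrs E V v) < 4 ^ r")
      case True
      then obtain u v where uv: "u \<in> V" "v \<in> V" "E u v" and few: "card (nbrs E V u \<inter> nbrs E V v) < 4 ^ r"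
        by blast
      define E' where "E' = (\<lambda>a b. a \<noteq> b \<and> (E a b \<or> (a = u \<and> E v b) \<or> (b = u \<and> E v a)))"
      have "u \<noteq> v" using uv E by (auto simp: irreflp_def)
      have cV: "card V = Suc (card (V - {v}))"
        using fin uv by (metis card_Suc_Diff1)
      \<comment> \<open>With fewer than \<open>4 ^ r\<close> common neighbours the contraction loses
        at most \<open>2 * 4 ^ r\<close> ordered pairs, whereas one vertex less lowers the required
        number by \<open>4 ^ Suc r\<close>.\<close>
      have "4 ^ Suc r * card (V - {v}) \<le> (\<Sum>w\<in>V - {v}. card (nbrs E' (V - {v}) w))"
        using sum_nbrs_contract[OF fin E uv E'_def] few less.prems(5) by (simp add: cV)
      moreover have "symp E'" "irreflp E'"
        using E by (auto simp: E'_def symp_def irreflp_def)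
      moreover have "card (V - {v}) < card V" "finite (V - {v})" "V - {v} \<noteq> {}"
        using cV fin uv \<open>u \<noteq> v\<close> by auto
      ultimately obtain X where "clique_minor E' (V - {v}) (Suc r) X"
        using less.hyps[of "V - {v}" E'] by blast
      then show ?thesis
        using clique_minor_uncontract[OF E(1) uv(3,1,2) \<open>u \<noteq> v\<close> E'_def] by blast
    next
      case False
      have "(\<Sum>w\<in>V. card (nbrs E V w)) > 0"
        using less.prems(1,2,5) by (metis card_gt_0_iff less_le_trans mult_pos_pos zero_less_numeral zero_less_power)
      then obtain v where v: "v \<in> V" "nbrs E V v \<noteq> {}"
        by (metis card.empty less_numeral_extra(3) sum.neutral)
      let ?N = "nbrs E V v"
      have "4 ^ r \<le> card (nbrs E ?N w)" if "w \<in> ?N" for w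
      proof -
        have "nbrs E ?N w = nbrs E V v \<inter> nbrs E V w" by (auto simp: nbrs_def)
        with that v False show ?thesis by (auto simp: nbrs_def not_less)
      qed
      then have "4 ^ r * card ?N \<le> (\<Sum>w\<in>?N. card (nbrs E ?N w))"
        using sum_bounded_below[of ?N "4 ^ r" "\<lambda>w. card (nbrs E ?N w)"] by (simp add: mult.commute)
      then obtain X where X: "clique_minor E ?N r X"
        using Suc.IH[of ?N E] finN v E by blast
      have "v \<notin> ?N" using E by (auto simp: nbrs_def irreflp_def)
      have ne: "X i \<noteq> {}" "X i \<subseteq> ?N" if "i < r" for i
        using X that by (auto simp: clique_minor_def conn_in_def)
      have "\<exists>y\<in>X i. E v y" "\<exists>y\<in>X i. E y v" "v \<notin> X i" "X i \<subseteq> V" if "i < r" for i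
        using ne[OF that] E(1) \<open>v \<notin> ?N\<close> by (auto simp: nbrs_def dest: sympD)
      \<comment> \<open>All branch sets found so far consist of neighbours of \<open>v\<close>, so
        \<open>{v}\<close> is adjacent to each of them and serves as the additional one.\<close>
      then have "clique_minor E V (Suc r) (X(r := {v}))"
        using X v(1) unfolding clique_minor_def less_Suc_eq by (simp add: conn_in_singleton)
      then show ?thesis by blast
    qed
  qed
qed

subsection \<open>Planar graphs have no clique minor on six vertices\<close>

definition vpath :: "('a \<Rightarrow> 'a \<Rightarrow> bool) \<Rightarrow> 'a list \<Rightarrow> 'a \<Rightarrow> 'a \<Rightarrow> bool" where
  "vpath E L a b \<longleftrightarrow> L \<noteq> [] \<and> hd L = a \<and> last L = b \<and> distinct L \<and> successively E L"

fun ledges :: "'a list \<Rightarrow> 'a set set" where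
  "ledges (x # y # L) = insert {x, y} (ledges (y # L))"
| "ledges L = {}"

lemma vpath_append:
  assumes "vpath E L a b" "vpath E M c d" "E b c" "set L \<inter> set M = {}"
  shows "vpath E (L @ M) a d"
  using assms by (auto simp: vpath_def successively_append_iff)

lemma vpath_rev:
  assumes "vpath E L a b" "symp E"
  shows "vpath E (rev L) b a"
proof -
  have E: "(\<lambda>x y. E y x) = E" using assms(2) by (auto simp: symp_def fun_eq_iff)
  have "successively E (rev L)"
    using assms(1) unfolding vpath_def successively_rev E by simp
  then show ?thesis using assms(1) by (simp add: vpath_def hd_rev last_rev del: successively_rev)
qed

lemma vpath_suffix:
  assumes "vpath E (L @ x # M) a b"
  shows "vpath E (x # M) x b"
  using assms by (auto simp: vpath_def successively_append_iff)

lemma vpath_prefix: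
  assumes "vpath E (L @ x # M) a b"
  shows "vpath E (L @ [x]) a x"
  using assms by (auto simp: vpath_def successively_append_iff hd_append)

lemma conn_in_vpath:
  assumes "conn_in E X" "a \<in> X" "b \<in> X"
  obtains L where "vpath E L a b" "set L \<subseteq> X"
proof -
  have "(\<lambda>a b. E a b \<and> a \<in> X \<and> b \<in> X)\<^sup>*\<^sup>* a b"
    using assms by (auto simp: conn_in_def)
  then have "\<exists>L. vpath E L a b \<and> set L \<subseteq> X"
  proof (induction rule: rtranclp_induct)
    case base
    then show ?case using assms by (intro exI[of _ "[a]"]) (auto simp: vpath_def)
  next
    case (step y z)
    then obtain L where L: "vpath E L a y" "set L \<subseteq> X" by blast
    show ?case
    proof (cases "z \<in> set L")
      case True
      then obtain L1 L2 where "L = L1 @ z # L2" by (meson split_list)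
      with L vpath_prefix[of E L1 z L2 a y] show ?thesis
        by (intro exI[of _ "L1 @ [z]"]) auto
    next
      case False
      with L step have "vpath E (L @ [z]) a z"
        by (intro vpath_append[OF L(1)]) (auto simp: vpath_def)
      with L step show ?thesis by (intro exI[of _ "L @ [z]"]) auto
    qed
  qed
  with that show thesis by blast
qed

lemma conn_in_Un:
  assumes E: "symp E" and X: "conn_in E X" and Y: "conn_in E Y" and XY: "\<exists>x\<in>X. \<exists>y\<in>Y. E x y"
  shows "conn_in E (X \<union> Y)"
proof -
  let ?R = "\<lambda>Z a b. E a b \<and> a \<in> Z \<and> b \<in> Z"
  obtain x y where xy: "x \<in> X" "y \<in> Y" "E x y" using XY by blast
  have lift: "(?R (X \<union> Y))\<^sup>*\<^sup>* u v" if "(?R Z)\<^sup>*\<^sup>* u v" "Z \<subseteq> X \<union> Y" for Z u v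
    using that(1) by (rule rtranclp_mono[THEN predicate2D, rotated]) (use that(2) in auto)
  have yx: "(?R (X \<union> Y))\<^sup>*\<^sup>* y x" using xy E by (auto dest: sympD)
  show ?thesis
  proof (rule conn_in_via[of x])
    fix z assume "z \<in> X \<union> Y"
    then show "(?R (X \<union> Y))\<^sup>*\<^sup>* z x"
    proof
      assume "z \<in> X"
      then show ?thesis using X xy by (intro lift[of X]) (auto simp: conn_in_def)
    next
      assume "z \<in> Y"
      then have "(?R (X \<union> Y))\<^sup>*\<^sup>* z y" using Y xy by (intro lift[of Y]) (auto simp: conn_in_def)
      then show ?thesis using yx by (rule rtranclp_trans)
    qed
  qed (use xy E in auto)
qed

text \<open>A subdivided claw with centre \<open>a\<close>, possibly degenerate: a leg may consist
  of \<open>a\<close> alone. Inside a branch set it links one point to three contact vertices, which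
  need not be distinct.\<close>

definition tripod ::
    "('a \<Rightarrow> 'a \<Rightarrow> bool) \<Rightarrow> 'a set \<Rightarrow> (nat \<Rightarrow> 'a) \<Rightarrow> 'a \<Rightarrow> (nat \<Rightarrow> 'a list) \<Rightarrow> bool" where
  "tripod E X t a L \<longleftrightarrow> a \<in> X \<and> (\<forall>i<3. vpath E (L i) a (t i) \<and> set (L i) \<subseteq> X) \<and>
    (\<forall>i<3. \<forall>j<3. i \<noteq> j \<longrightarrow> set (L i) \<inter> set (L j) = {a})"

text \<open>A path from \<open>t 2\<close> towards \<open>t 0\<close> is cut at its first vertex
  \<open>x\<close> on a path between \<open>t 0\<close> and \<open>t 1\<close>; this
  \<open>x\<close> is the centre.\<close>

lemma conn_in_tripod:
  assumes E: "symp E" and X: "conn_in E X" and t: "\<And>i. i < 3 \<Longrightarrow> t i \<in> X"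
  shows "\<exists>a L. tripod E X t a L"
proof -
  have t': "t 0 \<in> X" "t 1 \<in> X" "t 2 \<in> X" using t by auto
  obtain P where P: "vpath E P (t 0) (t 1)" "set P \<subseteq> X"
    using conn_in_vpath[OF X t'(1,2)] .
  obtain Q where Q: "vpath E Q (t 2) (t 0)" "set Q \<subseteq> X"
    using conn_in_vpath[OF X t'(3,1)] .
  have "\<exists>x\<in>set Q. x \<in> set P"
    using P(1) Q(1) by (metis hd_in_set last_in_set vpath_def)
  then obtain Q1 x Q2 where Q12: "Q = Q1 @ x # Q2" "x \<in> set P" "\<forall>y\<in>set Q1. y \<notin> set P"
    using split_list_first_prop[of Q "\<lambda>x. x \<in> set P"] by blast
  obtain P1 P2 where P12: "P = P1 @ x # P2"
    using Q12(2) by (meson split_list)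
  define L where "L = (\<lambda>i :: nat. if i = 0 then rev (P1 @ [x]) else if i = 1 then x # P2 else rev (Q1 @ [x]))"
  have i3: "i = 0 \<or> i = 1 \<or> i = 2" if "i < 3" for i :: nat using that by auto
  have "vpath E (rev (P1 @ [x])) x (t 0)" "vpath E (x # P2) x (t 1)" "vpath E (rev (Q1 @ [x])) x (t 2)"
    using P(1) Q(1) E unfolding P12 Q12(1)
    by (blast intro: vpath_rev vpath_prefix vpath_suffix)+
  then have 1: "vpath E (L i) x (t i)" if "i < 3" for i
    using i3[OF that] by (auto simp: L_def simp del: rev_append)
  have 2: "set (L i) \<subseteq> X" for i
    using P(2) Q(2) by (auto simp: L_def P12 Q12(1))
  have "distinct P" "distinct Q" using P Q by (auto simp: vpath_def)
  then have 3: "set (L i) \<inter> set (L j) = {x}" if "i < 3" "j < 3" "i \<noteq> j" for i j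
    using i3[OF that(1)] i3[OF that(2)] that(3) Q12(3) by (auto simp: L_def P12 Q12(1))
  have "x \<in> X" using P(2) by (simp add: P12)
  with 1 2 3 have "tripod E X t x L" by (simp add: tripod_def)
  then show ?thesis by blast
qed

lemma ledges_subset: "e \<in> ledges L \<Longrightarrow> e \<subseteq> set L"
  by (induction L rule: ledges.induct) auto

lemma ledges_edges:
  "successively (\<lambda>x y. {x, y} \<in> F) L \<Longrightarrow> ledges L \<subseteq> F"
  by (induction L rule: ledges.induct) auto

lemma set_subset_ledges: "length L \<ge> 2 \<Longrightarrow> x \<in> set L \<Longrightarrow> \<exists>e\<in>ledges L. x \<in> e"
proof (induction L rule: ledges.induct)
  case (1 x' y L)
  show ?case
  proof (cases "x = x' \<or> x = y")
    case False
    with 1(3) have "x \<in> set (y # L)" "length (y # L) \<ge> 2" by (cases L; auto)+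
    with 1(1) show ?thesis by auto
  qed auto
qed auto

text \<open>Serves to show that paths meeting only in their two ends share no edge: such an edge
  would have to join the ends.\<close>

lemma ends_notin_ledges:
  assumes "distinct L" "length L \<ge> 3"
  shows "{hd L, last L} \<notin> ledges L"
proof -
  obtain x y z M where L: "L = x # y # z # M"
    using assms(2) by (metis Suc_le_length_iff numeral_3_eq_3)
  have "last L \<in> set (z # M)" by (simp add: L)
  moreover have "x \<notin> \<Union> (ledges (y # z # M))"
    using assms(1) ledges_subset[of _ "y # z # M"] by (auto simp: L)
  ultimately show ?thesis
    using assms(1) unfolding L by (auto simp: doubleton_eq_iff simp del: last.simps ledges.simps(1)
      simp: ledges.simps(1)[of x])
qed

section \<open>Transfer from a graph to its drawing\<close>

definition vadj :: "'a ugraph \<Rightarrow> 'a \<Rightarrow> 'a \<Rightarrow> bool" where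
  "vadj G x y \<longleftrightarrow> {x, y} \<in> edges G"

locale drawing =
  fixes G :: "'a ugraph" and p :: "'a \<Rightarrow> complex" and \<gamma> :: "'a set \<Rightarrow> real \<Rightarrow> complex"
  assumes G: "simple_graph G" and drawing: "plane_drawing G p \<gamma>"
begin

abbreviation adj where "adj \<equiv> vadj G"

definition arcs :: "'a set set \<Rightarrow> complex set" where "arcs F = (\<Union>e\<in>F. path_image (\<gamma> e))"

text \<open>The drawing of the subgraph induced by \<open>X\<close>. Vertices are added separately,
  so that a single vertex has a nonempty region as well.\<close>

definition region :: "'a set \<Rightarrow> complex set" where
  "region X = p ` X \<union> arcs {e \<in> edges G. e \<subseteq> X}"

lemma symp_adj: "symp adj"
  by (simp add: vadj_def symp_def insert_commute)

lemma edge_verts: "e \<in> edges G \<Longrightarrow> e \<subseteq> verts G"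
  using G by (auto simp: simple_graph_def)

lemma adj_ne: "adj x y \<Longrightarrow> x \<noteq> y"
  using G by (auto simp: simple_graph_def vadj_def dest!: bspec)

lemma inj_p: "inj_on p (verts G)"
  using drawing by (simp add: plane_drawing_def)

lemma edge_arc:
  assumes "e \<in> edges G"
  shows "arc (\<gamma> e)" "{pathstart (\<gamma> e), pathfinish (\<gamma> e)} = p ` e" "path_image (\<gamma> e) \<inter> p ` verts G = p ` e"
  using drawing assms by (auto simp: plane_drawing_def)

lemma edge_ends: "e \<in> edges G \<Longrightarrow> p ` e \<subseteq> path_image (\<gamma> e)"
  using edge_arc(3) by blast

lemma edge_vertex: "e \<in> edges G \<Longrightarrow> v \<in> verts G \<Longrightarrow> p v \<in> path_image (\<gamma> e) \<longleftrightarrow> v \<in> e"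
  using edge_arc(3)[of e] inj_on_image_mem_iff[OF inj_p, of v e] edge_verts[of e] by blast

lemma edges_meet:
  "e \<in> edges G \<Longrightarrow> e' \<in> edges G \<Longrightarrow> e \<noteq> e' \<Longrightarrow> path_image (\<gamma> e) \<inter> path_image (\<gamma> e') \<subseteq> p ` (e \<inter> e')"
  using drawing by (simp add: plane_drawing_def)

text \<open>A drawing fixes the ends of an arc only as an unordered pair, so the arc may have to be
  reversed.\<close>

lemma edge_path:
  assumes "adj x y"
  obtains g where "arc g" "pathstart g = p x" "pathfinish g = p y" "path_image g = path_image (\<gamma> {x, y})"
proof -
  have e: "{x, y} \<in> edges G" using assms by (simp add: vadj_def)
  from edge_arc(2)[OF e] consider "pathstart (\<gamma> {x, y}) = p x" "pathfinish (\<gamma> {x, y}) = p y"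
    | "pathstart (\<gamma> {x, y}) = p y" "pathfinish (\<gamma> {x, y}) = p x"
    by (auto simp: doubleton_eq_iff)
  then show thesis
  proof cases
    case 1
    then show ?thesis using that[of "\<gamma> {x, y}"] edge_arc(1)[OF e] by simp
  next
    case 2
    then show ?thesis using that[of "reversepath (\<gamma> {x, y})"] edge_arc(1)[OF e] by (simp add: arc_reversepath)
  qed
qed

lemma vpath_arc:
  assumes "vpath adj L a b" "length L \<ge> 2"
  shows "\<exists>g. arc g \<and> pathstart g = p a \<and> pathfinish g = p b \<and> path_image g = arcs (ledges L)"
  using assms
proof (induction L arbitrary: a rule: ledges.induct)
  case (1 x y L)
  have ab: "a = x" "adj x y" "x \<noteq> y" "x \<notin> set (y # L)" using 1(2) by (auto simp: vpath_def)
  obtain g where g: "arc g" "pathstart g = p x" "pathfinish g = p y" "path_image g = path_image (\<gamma> {x, y})"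
    using edge_path[OF ab(2)] .
  show ?case
  proof (cases L)
    case Nil
    then show ?thesis using g 1(2) by (intro exI[of _ g]) (auto simp: vpath_def arcs_def)
  next
    case (Cons z M)
    have v: "vpath adj (y # L) y b"
      using 1(2) by (auto simp: vpath_def)
    then obtain h where h: "arc h" "pathstart h = p y" "pathfinish h = p b" "path_image h = arcs (ledges (y # L))"
      using 1(1) Cons by fastforce
    have "path_image g \<inter> path_image h \<subseteq> {pathstart h}"
    proof
      fix z assume z: "z \<in> path_image g \<inter> path_image h"
      then obtain e where e: "e \<in> ledges (y # L)" "z \<in> path_image (\<gamma> e)" by (auto simp: h arcs_def)
      have "x \<notin> e" using ledges_subset[OF e(1)] ab by auto
      moreover have "e \<in> edges G"
        using ledges_edges[of "edges G" "y # L"] v e(1) unfolding vpath_def vadj_def by blast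
      moreover have "{x, y} \<in> edges G" using ab by (simp add: vadj_def)
      ultimately have "z \<in> p ` ({x, y} \<inter> e)"
        using edges_meet[of "{x, y}" e] z e g by blast
      with \<open>x \<notin> e\<close> show "z \<in> {pathstart h}" by (auto simp: h)
    qed
    then have "arc (g +++ h)" using g h by (intro arc_join) auto
    then show ?thesis using g h ab
      by (intro exI[of _ "g +++ h"]) (auto simp: path_image_join arcs_def)
  qed
qed (auto simp: vpath_def)

lemma region_vertex:
  assumes "X \<subseteq> verts G" "v \<in> verts G"
  shows "p v \<in> region X \<longleftrightarrow> v \<in> X"
proof
  assume "p v \<in> region X"
  then consider "p v \<in> p ` X" | e where "e \<in> edges G" "e \<subseteq> X" "p v \<in> path_image (\<gamma> e)"
    by (auto simp: region_def arcs_def)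
  then show "v \<in> X"
  proof cases
    case 1
    then show ?thesis using inj_on_image_mem_iff[OF inj_p assms(2,1)] by simp
  next
    case 2
    then show ?thesis using edge_vertex[of e v] assms(2) by blast
  qed
qed (simp add: region_def)

lemma region_disjoint_arcs:
  assumes "X \<subseteq> verts G" "F \<subseteq> edges G" "X \<inter> \<Union> F = {}"
  shows "region X \<inter> arcs F = {}"
proof -
  have "z \<notin> path_image (\<gamma> e)" if e: "e \<in> F" and z: "z \<in> region X" for z e
  proof
    assume ze: "z \<in> path_image (\<gamma> e)"
    have eG: "e \<in> edges G" using e assms by blast
    from z consider v where "v \<in> X" "z = p v" | e' where "e' \<in> edges G" "e' \<subseteq> X" "z \<in> path_image (\<gamma> e')"
      by (auto simp: region_def arcs_def)
    then show False
    proof cases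
      case 1
      then show False using ze edge_vertex[OF eG, of v] assms e by auto
    next
      case 2
      have "e' \<noteq> {}" using 2(1) G by (auto simp: simple_graph_def)
      then have "e \<noteq> e'" using 2 assms e by blast
      then have "z \<in> p ` (e \<inter> e')" using edges_meet[OF eG 2(1)] ze 2 by blast
      then show False using 2 assms e by auto
    qed
  qed
  then show ?thesis by (auto simp: arcs_def)
qed

lemma connected_region:
  assumes "conn_in adj X"
  shows "connected (region X)"
proof -
  obtain v where v: "v \<in> X" using assms by (auto simp: conn_in_def)
  let ?R = "region X"
  have edge: "connected_component ?R (p x) z" if "e \<in> edges G" "e \<subseteq> X" "x \<in> e" "z \<in> path_image (\<gamma> e)" for e x z
    unfolding connected_component_def
  proof (intro exI conjI)
    show "connected (path_image (\<gamma> e))" using edge_arc(1)[OF that(1)] by (rule connected_arc_image)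
    show "path_image (\<gamma> e) \<subseteq> ?R" using that by (auto simp: region_def arcs_def)
    show "p x \<in> path_image (\<gamma> e)" using edge_ends[OF that(1)] that(3) by blast
  qed (use that in simp)
  have vert: "connected_component ?R (p v) (p x)" if "x \<in> X" for x
  proof -
    have "(\<lambda>a b. adj a b \<and> a \<in> X \<and> b \<in> X)\<^sup>*\<^sup>* v x"
      using assms v that by (auto simp: conn_in_def)
    then show ?thesis
    proof (induction rule: rtranclp_induct)
      case base
      then show ?case using v by (simp add: region_def)
    next
      case (step y z)
      then have "connected_component ?R (p y) (p z)"
        using edge_ends[of "{y, z}"] by (intro edge[of "{y, z}"]) (auto simp: vadj_def)
      with step.IH show ?case by (rule connected_component_trans)
    qed
  qed
  have "connected_component ?R (p v) z" if "z \<in> ?R" for z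
  proof -
    from that consider x where "x \<in> X" "z = p x" | e where "e \<in> edges G" "e \<subseteq> X" "z \<in> path_image (\<gamma> e)"
      by (auto simp: region_def arcs_def)
    then show ?thesis
    proof cases
      case 2
      have "e \<noteq> {}" using 2(1) G by (auto simp: simple_graph_def)
      then obtain x where "x \<in> e" by blast
      then show ?thesis using 2 edge[of e x z] vert[of x] connected_component_trans by blast
    qed (use vert in simp)
  qed
  then have "\<forall>x\<in>?R. \<forall>y\<in>?R. connected_component ?R x y"
    by (meson connected_component_sym connected_component_trans)
  then show ?thesis by (simp add: connected_iff_connected_component)
qed

lemma arcs_meet:
  assumes "F \<subseteq> edges G" "F' \<subseteq> edges G" "F \<inter> F' = {}"
  shows "arcs F \<inter> arcs F' \<subseteq> p ` (\<Union> F \<inter> \<Union> F')"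
proof
  fix z assume "z \<in> arcs F \<inter> arcs F'"
  then obtain e e' where e: "e \<in> F" "e' \<in> F'" "z \<in> path_image (\<gamma> e) \<inter> path_image (\<gamma> e')"
    by (auto simp: arcs_def)
  then have "z \<in> p ` (e \<inter> e')"
    using edges_meet[of e e'] assms by blast
  then show "z \<in> p ` (\<Union> F \<inter> \<Union> F')" using e by blast
qed

lemma no_clique_minor: "\<not> clique_minor adj (verts G) 6 X"
proof
  assume X: "clique_minor adj (verts G) 6 X"
  have X1: "conn_in adj (X i)" "X i \<subseteq> verts G" if "i < 6" for i
    using X that by (auto simp: clique_minor_def)
  have X2: "X i \<inter> X j = {}" "\<exists>x\<in>X i. \<exists>y\<in>X j. adj x y" if "i < 6" "j < 6" "i \<noteq> j" for i j
    using X that by (auto simp: clique_minor_def)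
  define B where "B = (\<lambda>i. X (3 + i))"
  have B: "conn_in adj (B i)" "B i \<subseteq> verts G" if "i < 3" for i
    using X1[of "3 + i"] that by (auto simp: B_def)
  have BX: "X j \<inter> B i = {}" "\<exists>x\<in>X j. \<exists>y\<in>B i. adj x y" if "i < 3" "j < 3" for i j
    using X2[of j "3 + i"] that by (auto simp: B_def)
  have BB: "B i \<inter> B j = {}" if "i < 3" "j < 3" "i \<noteq> j" for i j
    using X2(1)[of "3 + i" "3 + j"] that by (simp add: B_def)
  have "\<forall>i. i < 3 \<longrightarrow> (\<exists>st. snd st \<in> B i \<and> fst st \<in> X 0 \<and> adj (fst st) (snd st))"
    using BX(2)[of _ 0] by fastforce
  then obtain f where f: "\<And>i. i < 3 \<Longrightarrow> snd (f i) \<in> B i \<and> fst (f i) \<in> X 0 \<and> adj (fst (f i)) (snd (f i))"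
    by metis
  have "\<forall>i. i < 3 \<longrightarrow> (\<exists>st. snd st \<in> B i \<and> fst st \<in> X 1 \<and> adj (fst st) (snd st))"
    using BX(2)[of _ 1] by fastforce
  then obtain g where g: "\<And>i. i < 3 \<Longrightarrow> snd (g i) \<in> B i \<and> fst (g i) \<in> X 1 \<and> adj (fst (g i)) (snd (g i))"
    by metis
  have "conn_in adj (X 0)" "\<And>i. i < 3 \<Longrightarrow> fst (f i) \<in> X 0"
    using X1(1)[of 0] f by simp_all
  then have "\<exists>a L. tripod adj (X 0) (\<lambda>i. fst (f i)) a L"
    by (rule conn_in_tripod[OF symp_adj])
  then obtain a L where tL: "tripod adj (X 0) (\<lambda>i. fst (f i)) a L"
    by (elim exE)
  have L: "a \<in> X 0" "\<And>i. i < 3 \<Longrightarrow> vpath adj (L i) a (fst (f i))" "\<And>i. i < 3 \<Longrightarrow> set (L i) \<subseteq> X 0"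
    "\<And>i j. i < 3 \<Longrightarrow> j < 3 \<Longrightarrow> i \<noteq> j \<Longrightarrow> set (L i) \<inter> set (L j) = {a}"
    using tL by (simp_all add: tripod_def)
  have "conn_in adj (X 1)" "\<And>i. i < 3 \<Longrightarrow> fst (g i) \<in> X 1"
    using X1(1)[of 1] g by simp_all
  then have "\<exists>b R. tripod adj (X 1) (\<lambda>i. fst (g i)) b R"
    by (rule conn_in_tripod[OF symp_adj])
  then obtain b R where tR: "tripod adj (X 1) (\<lambda>i. fst (g i)) b R"
    by (elim exE)
  have R: "b \<in> X 1" "\<And>i. i < 3 \<Longrightarrow> vpath adj (R i) b (fst (g i))" "\<And>i. i < 3 \<Longrightarrow> set (R i) \<subseteq> X 1"
    "\<And>i j. i < 3 \<Longrightarrow> j < 3 \<Longrightarrow> i \<noteq> j \<Longrightarrow> set (R i) \<inter> set (R j) = {b}"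
    using tR by (simp_all add: tripod_def)
  have "\<forall>i. i < 3 \<longrightarrow> (\<exists>M. vpath adj M (snd (f i)) (snd (g i)) \<and> set M \<subseteq> B i)"
    using conn_in_vpath B(1) f g by metis
  then obtain M where M: "\<And>i. i < 3 \<Longrightarrow> vpath adj (M i) (snd (f i)) (snd (g i))" "\<And>i. i < 3 \<Longrightarrow> set (M i) \<subseteq> B i"
    by metis
  define P where "P = (\<lambda>i. L i @ M i @ rev (R i))"
  have X01: "X 0 \<inter> X 1 = {}" using X2(1)[of 0 1] by simp
  have P: "vpath adj (P i) a b" "length (P i) \<ge> 3" "set (P i) \<subseteq> verts G" if i: "i < 3" for i
  proof -
    have BX': "X 0 \<inter> B i = {}" "X 1 \<inter> B i = {}" using BX(1)[OF i] by simp_all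
    have "vpath adj (M i @ rev (R i)) (snd (f i)) b"
    proof (rule vpath_append[OF M(1)[OF i] vpath_rev[OF R(2)[OF i] symp_adj]])
      show "adj (snd (g i)) (fst (g i))" using g[OF i] symp_adj by (auto dest: sympD)
      show "set (M i) \<inter> set (rev (R i)) = {}" using M(2)[OF i] R(3)[OF i] BX' by auto
    qed
    then show "vpath adj (P i) a b"
      unfolding P_def
    proof (rule vpath_append[OF L(2)[OF i]])
      show "adj (fst (f i)) (snd (f i))" using f[OF i] by simp
      show "set (L i) \<inter> set (M i @ rev (R i)) = {}" using L(3)[OF i] M(2)[OF i] R(3)[OF i] BX' X01 by auto
    qed
    have "L i \<noteq> []" "M i \<noteq> []" "R i \<noteq> []"
      using L(2)[OF i] M(1)[OF i] R(2)[OF i] by (simp_all add: vpath_def)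
    then show "length (P i) \<ge> 3"
      by (simp add: P_def Suc_le_eq numeral_3_eq_3 add_pos_pos length_greater_0_conv[symmetric] del: length_greater_0_conv)
    show "set (P i) \<subseteq> verts G"
      using L(3)[OF i] M(2)[OF i] R(3)[OF i] X1(2)[of 0] X1(2)[of 1] B(2)[OF i] by (auto simp: P_def)
  qed
  have PF: "ledges (P i) \<subseteq> edges G" if "i < 3" for i
    using ledges_edges[of "edges G" "P i"] P(1)[OF that] unfolding vpath_def vadj_def by blast
  have PU: "\<Union> (ledges (P i)) = set (P i)" if "i < 3" for i
    using ledges_subset[of _ "P i"] set_subset_ledges[of "P i"] P(2)[OF that] by force
  have PP: "set (P i) \<inter> set (P j) \<subseteq> {a, b}" if ij: "i < 3" "j < 3" "i \<noteq> j" for i j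
  proof -
    have "x \<in> {a, b}" if x: "x \<in> set (P i)" "x \<in> set (P j)" for x
    proof -
      have s: "set (L k) \<subseteq> X 0" "set (M k) \<subseteq> B k" "set (R k) \<subseteq> X 1" if "k < 3" for k
        using that L(3) M(2) R(3) by auto
      have d: "B i \<inter> B j = {}" "X 0 \<inter> B i = {}" "X 1 \<inter> B i = {}" "X 0 \<inter> B j = {}" "X 1 \<inter> B j = {}"
        using BB ij BX(1) by simp_all
      have "x \<in> set (L i) \<and> x \<in> set (L j) \<or> x \<in> set (R i) \<and> x \<in> set (R j)"
        using x s[OF ij(1)] s[OF ij(2)] d X01 unfolding P_def by auto
      then show ?thesis using L(4)[OF ij] R(4)[OF ij] by auto
    qed
    then show ?thesis by auto
  qed
  \<comment> \<open>A common edge could only be \<open>{a, b}\<close>, but each path has a vertex in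
    \<open>X 0\<close>, in \<open>B i\<close> and in \<open>X 1\<close>, and thus its ends are not
    joined by one of its edges.\<close>
  have Pe: "ledges (P i) \<inter> ledges (P j) = {}" if ij: "i < 3" "j < 3" "i \<noteq> j" for i j
  proof -
    have "e \<notin> ledges (P j)" if e: "e \<in> ledges (P i)" for e
    proof
      assume "e \<in> ledges (P j)"
      then have "e \<subseteq> {a, b}"
        using e ledges_subset PP[OF ij] by blast
      moreover have "card e = 2" using PF[OF ij(1)] e G by (auto simp: simple_graph_def)
      moreover have "card {a, b} \<le> 2" using card_length[of "[a, b]"] by simp
      ultimately have "e = {a, b}" by (metis card_seteq finite.emptyI finite_insert)
      then show False
        using ends_notin_ledges[of "P i"] P(1,2)[OF ij(1)] e by (auto simp: vpath_def)
    qed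
    then show ?thesis by blast
  qed
  have "\<forall>i. i < 3 \<longrightarrow> (\<exists>c. arc c \<and> pathstart c = p a \<and> pathfinish c = p b \<and> path_image c = arcs (ledges (P i)))"
    using vpath_arc[OF P(1)] P(2) by fastforce
  then obtain c where c: "\<And>i. i < 3 \<Longrightarrow>
      arc (c i) \<and> pathstart (c i) = p a \<and> pathfinish (c i) = p b \<and> path_image (c i) = arcs (ledges (P i))"
    by metis
  obtain y where y: "y \<in> X 2" using X1(1)[of 2] by (auto simp: conn_in_def)
  have X2': "X 0 \<inter> X 2 = {}" "X 1 \<inter> X 2 = {}" using X2(1)[of 0 2] X2(1)[of 1 2] by simp_all
  have Zsub: "X 2 \<union> B i \<subseteq> verts G" if "i < 3" for i
    using that X1(2)[of 2] B(2)[of i] by auto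
  show False
  proof (rule theta_no_common_neighbour[of c "p a" "p b" "\<lambda>i. region (X 2 \<union> B i)" "p y"])
    fix i :: nat assume i: "i < 3"
    show "arc (c i) \<and> pathstart (c i) = p a \<and> pathfinish (c i) = p b" using c[OF i] by simp
    have "conn_in adj (X 2 \<union> B i)"
    proof (rule conn_in_Un[OF symp_adj X1(1) B(1)[OF i]])
      show "\<exists>x\<in>X 2. \<exists>y\<in>B i. adj x y" using BX(2)[OF i, of 2] by simp
    qed simp
    moreover have "a \<in> verts G" "b \<in> verts G" "a \<notin> X 2 \<union> B i" "b \<notin> X 2 \<union> B i"
      using L(1) R(1) X1(2)[of 0] X1(2)[of 1] X2' BX(1)[OF i, of 0] BX(1)[OF i, of 1] by auto
    ultimately show "connected (region (X 2 \<union> B i)) \<and> p y \<in> region (X 2 \<union> B i) \<and>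
        p a \<notin> region (X 2 \<union> B i) \<and> p b \<notin> region (X 2 \<union> B i)"
      using connected_region region_vertex[OF Zsub[OF i]] y by (simp add: region_def)
    have s: "snd (f i) \<in> B i" "snd (f i) \<in> set (P i)"
      using f[OF i] M(1)[OF i] hd_in_set[of "M i"] by (auto simp: vpath_def P_def)
    then obtain e where e: "e \<in> ledges (P i)" "snd (f i) \<in> e"
      using PU[OF i] by blast
    then have "p (snd (f i)) \<in> path_image (c i)"
      using c[OF i] edge_ends[of e] PF[OF i] by (auto simp: arcs_def)
    moreover have "p (snd (f i)) \<in> region (X 2 \<union> B i)" using s by (simp add: region_def)
    ultimately show "region (X 2 \<union> B i) \<inter> path_image (c i) \<noteq> {}" by blast
  next
    fix i j :: nat assume ij: "i < 3" "j < 3" "i \<noteq> j"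
    show "path_image (c i) \<inter> path_image (c j) \<subseteq> {p a, p b}"
    proof -
      have "arcs (ledges (P i)) \<inter> arcs (ledges (P j)) \<subseteq> p ` (set (P i) \<inter> set (P j))"
        using arcs_meet[OF PF[OF ij(1)] PF[OF ij(2)] Pe[OF ij]] PU ij by simp
      also have "\<dots> \<subseteq> {p a, p b}" using PP[OF ij] by auto
      finally show ?thesis using c ij by simp
    qed
    have "(X 2 \<union> B i) \<inter> set (P j) = {}"
      using L(3)[OF ij(2)] M(2)[OF ij(2)] R(3)[OF ij(2)] X2' BB[OF ij]
        BX(1)[OF ij(1), of 0] BX(1)[OF ij(1), of 1] BX(1)[OF ij(2), of 2] by (auto simp: P_def)
    then show "region (X 2 \<union> B i) \<inter> path_image (c j) = {}"
      using region_disjoint_arcs[OF Zsub[OF ij(1)] PF[OF ij(2)]] PU[OF ij(2)] c[OF ij(2)] by simp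
  qed
qed

end

subsection \<open>Orientations of bounded outdegree and generating sets of oriented cycles\<close>

lemma clique_minor_mono: "clique_minor E W r X \<Longrightarrow> W \<subseteq> V \<Longrightarrow> clique_minor E V r X"
  unfolding clique_minor_def by blast

text \<open>Degeneracy: a vertex with at most \<open>D\<close> neighbours is removed, the rest is
  oriented, and all edges at the removed vertex are directed away from it.\<close>

lemma bounded_outdegree_orientation:
  assumes "finite V"
    and "\<And>W. W \<subseteq> V \<Longrightarrow> W \<noteq> {} \<Longrightarrow> \<exists>w\<in>W. card (nbrs E W w) \<le> D"
    and "symp E"
  shows "\<exists>out. (\<forall>x\<in>V. \<forall>y\<in>V. E x y \<longrightarrow> y \<in> out x \<or> x \<in> out y) \<and> (\<forall>x. finite (out x) \<and> card (out x) \<le> D)"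
  using assms
proof (induction "card V" arbitrary: V rule: less_induct)
  case less
  show ?case
  proof (cases "V = {}")
    case True
    then show ?thesis by (intro exI[of _ "\<lambda>_. {}"]) simp
  next
    case False
    then obtain v where v: "v \<in> V" "card (nbrs E V v) \<le> D"
      using less.prems(2)[of V] by blast
    have "card (V - {v}) < card V"
      using v(1) less.prems(1) by (meson card_Diff1_less)
    then have "\<exists>out. (\<forall>x\<in>V - {v}. \<forall>y\<in>V - {v}. E x y \<longrightarrow> y \<in> out x \<or> x \<in> out y) \<and>
        (\<forall>x. finite (out x) \<and> card (out x) \<le> D)"
      using less.prems by (intro less.hyps) auto
    then obtain out where out: "\<forall>x\<in>V - {v}. \<forall>y\<in>V - {v}. E x y \<longrightarrow> y \<in> out x \<or> x \<in> out y"
        "\<forall>x. finite (out x) \<and> card (out x) \<le> D"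
      by blast
    let ?o = "out(v := nbrs E V v)"
    have "y \<in> ?o x \<or> x \<in> ?o y" if "x \<in> V" "y \<in> V" "E x y" for x y
      using that out(1) sympD[OF less.prems(3) that(3)] by (auto simp: nbrs_def)
    moreover have "finite (?o x) \<and> card (?o x) \<le> D" for x
      using out(2) v(2) less.prems(1) by (simp add: nbrs_def)
    ultimately show ?thesis by blast
  qed
qed

text \<open>If every vertex had degree above \<open>4 ^ 6\<close> inside some \<open>W\<close>, the
  density bound for six branch sets would apply to \<open>W\<close>. A minor found in
  \<open>W\<close> is a minor of the whole graph, so no drawing of the induced subgraph has to be
  formed.\<close>

lemma planar_orientation:
  assumes "simple_graph G" "planar G"
  shows "\<exists>out. (\<forall>x y. {x, y} \<in> edges G \<longrightarrow> y \<in> out x \<or> x \<in> out y) \<and>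
    (\<forall>x. finite (out x) \<and> card (out x) \<le> 4 ^ 6)"
proof -
  obtain p \<gamma> where "plane_drawing G p \<gamma>" using assms(2) by (auto simp: planar_def)
  then interpret drawing G p \<gamma> using assms(1) by unfold_locales
  have fin: "finite (verts G)" using assms(1) by (simp add: simple_graph_def)
  have "\<exists>w\<in>W. card (nbrs adj W w) \<le> 4 ^ 6" if W: "W \<subseteq> verts G" "W \<noteq> {}" for W
  proof (rule ccontr)
    assume "\<not> ?thesis"
    then have "4 ^ 6 \<le> card (nbrs adj W w)" if "w \<in> W" for w
      using that by (meson nat_le_linear)
    then have "card W * 4 ^ 6 \<le> (\<Sum>w\<in>W. card (nbrs adj W w))"
      using sum_bounded_below[of W "4 ^ 6" "\<lambda>w. card (nbrs adj W w)"] by simp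
    then have "4 ^ 6 * card W \<le> (\<Sum>w\<in>W. card (nbrs adj W w))"
      by (simp only: mult.commute)
    moreover have "irreflp adj" using adj_ne by (auto simp: irreflp_def)
    moreover have "finite W" using fin W(1) by (rule rev_finite_subset)
    ultimately obtain X where "clique_minor adj W 6 X"
      using dense_imp_clique_minor[OF _ W(2) symp_adj] by blast
    then show False
      using no_clique_minor clique_minor_mono[OF _ W(1)] by blast
  qed
  then have "\<exists>out. (\<forall>x\<in>verts G. \<forall>y\<in>verts G. adj x y \<longrightarrow> y \<in> out x \<or> x \<in> out y) \<and>
      (\<forall>x. finite (out x) \<and> card (out x) \<le> 4 ^ 6)"
    by (intro bounded_outdegree_orientation fin symp_adj) auto
  moreover have "x \<in> verts G \<and> y \<in> verts G" if "{x, y} \<in> edges G" for x y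
    using edge_verts[OF that] by simp
  ultimately show ?thesis unfolding vadj_def by blast
qed

text \<open>Positions on the cycle are taken modulo \<open>k\<close>, and \<open>P i\<close> says that the edge between positions \<open>i\<close>
  and \<open>i + 1\<close> is directed forwards.\<close>

definition closed_under :: "nat \<Rightarrow> (nat \<Rightarrow> bool) \<Rightarrow> nat set \<Rightarrow> bool" where
  "closed_under k P T \<longleftrightarrow> (\<forall>i. i \<in> T \<longleftrightarrow> i mod k \<in> T) \<and> (\<forall>i. i \<in> T \<longrightarrow> P i \<longrightarrow> Suc i \<in> T) \<and>
     (\<forall>i. Suc i \<in> T \<longrightarrow> \<not> P i \<longrightarrow> i \<in> T) \<and> (\<forall>i. i \<in> T \<longrightarrow> Suc (Suc i) \<in> T \<longrightarrow> Suc i \<in> T)"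

text \<open>Positions are not reduced modulo \<open>k\<close> here, so windows that run past the end
  of the cycle need no special treatment; \<open>generates_all\<close> reduces them at the
  end.\<close>

definition generates :: "nat \<Rightarrow> (nat \<Rightarrow> bool) \<Rightarrow> nat \<Rightarrow> nat \<Rightarrow> nat \<Rightarrow> bool" where
  "generates k P q a b \<longleftrightarrow>
     (\<exists>S. finite S \<and> card S \<le> q \<and> (\<forall>T. closed_under k P T \<longrightarrow> S \<subseteq> T \<longrightarrow> {a..b} \<subseteq> T))"

lemma closed_underD:
  assumes "closed_under k P T"
  shows "i \<in> T \<longleftrightarrow> i mod k \<in> T" "i \<in> T \<Longrightarrow> P i \<Longrightarrow> Suc i \<in> T" "Suc i \<in> T \<Longrightarrow> \<not> P i \<Longrightarrow> i \<in> T"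
    "i \<in> T \<Longrightarrow> Suc (Suc i) \<in> T \<Longrightarrow> Suc i \<in> T"
proof -
  note c = assms[unfolded closed_under_def]
  show "i \<in> T \<longleftrightarrow> i mod k \<in> T"
    by (rule c[THEN conjunct1, rule_format])
  show "Suc i \<in> T" if "i \<in> T" "P i"
    by (rule c[THEN conjunct2, THEN conjunct1, rule_format, OF that])
  show "i \<in> T" if "Suc i \<in> T" "\<not> P i"
    by (rule c[THEN conjunct2, THEN conjunct2, THEN conjunct1, rule_format, OF that])
  show "Suc i \<in> T" if "i \<in> T" "Suc (Suc i) \<in> T"
    by (rule c[THEN conjunct2, THEN conjunct2, THEN conjunct2, rule_format, OF that])
qed

lemma generatesI:
  assumes "\<And>T. closed_under k P T \<Longrightarrow> s \<in> T \<Longrightarrow> {a..b} \<subseteq> T"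
  shows "generates k P 1 a b"
  unfolding generates_def
proof (intro exI conjI allI impI)
  show "{a..b} \<subseteq> T" if "closed_under k P T" "{s} \<subseteq> T" for T
    using assms[OF that(1)] that(2) by blast
qed simp_all

lemma generates_pair:
  shows "generates k P 1 a (a + 1)"
proof (rule generatesI)
  fix T
  assume T: "closed_under k P T" "(if P a then a else Suc a) \<in> T"
  have mem: "a \<in> T \<and> Suc a \<in> T"
    using T(2) closed_underD(2,3)[OF T(1), of "a"]
    by (smt (verit))
  show "{a..a + 1} \<subseteq> T"
  proof
    fix x assume "x \<in> {a..a + 1}"
    then have "x = a \<or> x = Suc a"
      unfolding atLeastAtMost_iff by presburger
    with mem show "x \<in> T" by blast
  qed
qed

text \<open>The assumption says that the middle position is not a sink. Hence one of the three
  positions reaches both others along directed edges; the nested conditional in the proof picks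
  it.\<close>

lemma generates_triple:
  assumes "P a \<Longrightarrow> P (Suc a)"
  shows "generates k P 1 a (a + 2)"
proof (rule generatesI)
  fix T
  assume T: "closed_under k P T" "(if P a then a else if P (Suc a) then Suc a else Suc (Suc a)) \<in> T"
  have mem: "a \<in> T \<and> Suc a \<in> T \<and> Suc (Suc a) \<in> T"
    using assms T(2) closed_underD(2,3)[OF T(1), of "a"] closed_underD(2,3)[OF T(1), of "Suc a"]
    by (smt (verit))
  show "{a..a + 2} \<subseteq> T"
  proof
    fix x assume "x \<in> {a..a + 2}"
    then have "x = a \<or> x = Suc a \<or> x = Suc (Suc a)"
      unfolding atLeastAtMost_iff by presburger
    with mem show "x \<in> T" by blast
  qed
qed

text \<open>Without a sink in the middle, the edges of the window point backwards up to some
  position and forwards from there on. This turning point is the generator.\<close>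

lemma generates_quad:
  assumes "P a \<Longrightarrow> P (Suc a)" "P (Suc a) \<Longrightarrow> P (Suc (Suc a))"
  shows "generates k P 1 a (a + 3)"
proof (rule generatesI)
  fix T
  assume T: "closed_under k P T" "(if P a then a else if P (Suc a) then Suc a else if P (Suc (Suc a)) then Suc (Suc a) else Suc (Suc (Suc a))) \<in> T"
  have mem: "a \<in> T \<and> Suc a \<in> T \<and> Suc (Suc a) \<in> T \<and> Suc (Suc (Suc a)) \<in> T"
    using assms T(2) closed_underD(2,3)[OF T(1), of "a"] closed_underD(2,3)[OF T(1), of "Suc a"] closed_underD(2,3)[OF T(1), of "Suc (Suc a)"]
    by (smt (verit))
  show "{a..a + 3} \<subseteq> T"
  proof
    fix x assume "x \<in> {a..a + 3}"
    then have "x = a \<or> x = Suc a \<or> x = Suc (Suc a) \<or> x = Suc (Suc (Suc a))"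
      unfolding atLeastAtMost_iff by presburger
    with mem show "x \<in> T" by blast
  qed
qed

lemma generates_eq: "generates k P q a b \<Longrightarrow> q = q' \<Longrightarrow> a = a' \<Longrightarrow> b = b' \<Longrightarrow> generates k P q' a' b'"
  by simp

text \<open>The skipped position \<open>b + 1\<close> is enclosed by two generated ones, so the last
  closure rule supplies it.\<close>

lemma generates_join:
  assumes "generates k P q a b" "generates k P q' (b + 2) c" "a \<le> b" "b + 2 \<le> c"
  shows "generates k P (q + q') a c"
proof -
  obtain S S' where S: "finite S" "card S \<le> q" "\<And>T. closed_under k P T \<Longrightarrow> S \<subseteq> T \<Longrightarrow> {a..b} \<subseteq> T"
    and S': "finite S'" "card S' \<le> q'" "\<And>T. closed_under k P T \<Longrightarrow> S' \<subseteq> T \<Longrightarrow> {b + 2..c} \<subseteq> T"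
    using assms(1,2) unfolding generates_def by blast
  have "{a..c} \<subseteq> T" if T: "closed_under k P T" "S \<union> S' \<subseteq> T" for T
  proof -
    have "{a..b} \<subseteq> T" "{b + 2..c} \<subseteq> T" using S(3) S'(3) T by auto
    moreover from this have "b \<in> T" "Suc (Suc b) \<in> T"
      using assms(3,4) by auto
    then have "Suc b \<in> T" by (rule closed_underD(4)[OF T(1)])
    moreover have "{a..c} = {a..b} \<union> {Suc b} \<union> {b + 2..c}" using assms(3,4) by auto
    ultimately show ?thesis by blast
  qed
  moreover have "card (S \<union> S') \<le> q + q'"
    using S(2) S'(2) card_Un_le[of S S'] by linarith
  ultimately show ?thesis
    unfolding generates_def using S(1) S'(1) by (intro exI[of _ "S \<union> S'"]) blast
qed

text \<open>There are \<open>t + 1\<close> pairs with \<open>t\<close> single gaps between them,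
  which makes \<open>3 * t + 2\<close> positions.\<close>

lemma generates_pairs: "generates k P (t + 1) a (a + 3 * t + 1)"
proof (induction t)
  case 0
  then show ?case using generates_pair[of k P a] by simp
next
  case (Suc t)
  have step: "generates k P 1 (a + 3 * t + 1 + 2) (a + 3 * Suc t + 1)"
    by (rule generates_eq[OF generates_pair[of k P "a + 3 * t + 3"]]) simp_all
  show ?case
    by (rule generates_eq[OF generates_join[OF Suc step]]) simp_all
qed

lemma generates_append_pairs:
  assumes "generates k P q a b" "a \<le> b"
  shows "generates k P (q + t) a (b + 3 * t)"
proof (cases t)
  case (Suc s)
  have "generates k P (s + 1) (b + 2) (b + 3 * t)"
    by (rule generates_eq[OF generates_pairs[of k P s "b + 2"]]) (simp_all add: Suc)
  from generates_join[OF assms(1) this assms(2)] show ?thesis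
    by (simp add: Suc)
qed (use assms in simp)

lemma generates_all:
  assumes "generates k P q a (a + k - 2)" "k \<ge> 2"
  shows "\<exists>S. S \<subseteq> {..<k} \<and> card S \<le> q \<and> (\<forall>T. closed_under k P T \<longrightarrow> S \<subseteq> T \<longrightarrow> T = UNIV)"
proof -
  obtain S where S: "finite S" "card S \<le> q" "\<And>T. closed_under k P T \<Longrightarrow> S \<subseteq> T \<Longrightarrow> {a..a + k - 2} \<subseteq> T"
    using assms(1) unfolding generates_def by blast
  have "T = UNIV" if T: "closed_under k P T" "(\<lambda>s. s mod k) ` S \<subseteq> T" for T
  proof -
    note per = closed_underD(1)[OF T(1)]
    have "s \<in> T" if "s \<in> S" for s
      using T(2) that per[of s] by blast
    then have 1: "{a..a + k - 2} \<subseteq> T" using S(3) T(1) by blast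
    \<comment> \<open>The missing position \<open>a + k - 1\<close> lies between
      \<open>a + k - 2\<close> and \<open>a + k\<close>, and the latter is \<open>a\<close> again
      modulo \<open>k\<close>.\<close>
    then have "a \<in> T" "a + k - 2 \<in> T" using assms(2) by auto
    moreover from this have "a + k \<in> T" using per[of a] per[of "a + k"] by simp
    moreover have "Suc (Suc (a + k - 2)) = a + k" "Suc (a + k - 2) = a + k - 1" using assms(2) by auto
    ultimately have "a + k - 1 \<in> T" using closed_underD(4)[OF T(1), of "a + k - 2"] by simp
    then have 2: "j \<in> T" if "a \<le> j" "j < a + k" for j
      using 1 that by (cases "j = a + k - 1") auto
    have "i \<in> T" for i
    proof -
      \<comment> \<open>\<open>(k - 1) * a\<close> stands for minus \<open>a\<close> modulo
        \<open>k\<close>, so \<open>?j\<close> is the representative of \<open>i\<close> in the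
        window from \<open>a\<close> to \<open>a + k - 1\<close>.\<close>
      let ?j = "a + (i + (k - 1) * a) mod k"
      have "?j < a + k" using assms(2) by simp
      then have "?j mod k \<in> T" using 2[of ?j] per[of ?j] by simp
      moreover have "a + (i + (k - 1) * a) = i + k * a" using assms(2) by (cases k) simp_all
      then have "(a + (i + (k - 1) * a)) mod k = i mod k" by (simp only: mod_mult_self2)
      then have "?j mod k = i mod k" by (simp only: mod_add_right_eq)
      ultimately show ?thesis using per[of i] by simp
    qed
    then show ?thesis by blast
  qed
  moreover have "card ((\<lambda>s. s mod k) ` S) \<le> q" using S(1,2) card_image_le le_trans by blast
  moreover have "(\<lambda>s. s mod k) ` S \<subseteq> {..<k}" using assms(2) by auto
  ultimately show ?thesis by blast
qed

text \<open>A window of \<open>k - 1\<close> positions is needed. With \<open>m\<close> generators,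
  pairs cover \<open>3 * m - 1\<close> positions. A triple in place of a pair gains one position,
  which settles \<open>k = 3 * m + 1\<close>. A quad or two triples gain two, which settles
  \<open>k = 3 * m + 2\<close>.\<close>

lemma cycle_generating_set:
  assumes k: "k \<ge> 5" and per: "\<And>i. P (i + k) = P i"
  shows "\<exists>S. S \<subseteq> {..<k} \<and> card S \<le> k div 3 \<and> (\<forall>T. closed_under k P T \<longrightarrow> S \<subseteq> T \<longrightarrow> T = UNIV)"
proof -
  \<comment> \<open>The index is shifted: \<open>sink i\<close> means that both edges at position
    \<open>i + 1\<close> point to it. So \<open>\<not> sink a\<close> is exactly the assumption of a
    triple that starts at \<open>a\<close>.\<close>
  define sink where "sink = (\<lambda>i. P i \<and> \<not> P (Suc i))"
  have sink_adj: "\<not> (sink i \<and> sink (Suc i))" for i by (simp add: sink_def)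
  define m where "m = k div 3"
  consider (0) "k = 3 * m" "m \<ge> 2" | (1) "k = 3 * m + 1" "m \<ge> 2" | (2) "k = 3 * m + 2" "m \<ge> 1"
    using k unfolding m_def by linarith
  then have "\<exists>a. generates k P m a (a + k - 2)"
  proof cases
    case 0
    have "generates k P m 0 (0 + k - 2)"
      by (rule generates_eq[OF generates_pairs[of k P "m - 1" 0]]) (use 0 in simp_all)
    then show ?thesis by blast
  next
    case 1
    obtain a where "\<not> sink a" using sink_adj by blast
    then have "generates k P 1 a (a + 2)"
      by (intro generates_triple) (simp add: sink_def)
    then have "generates k P (1 + (m - 1)) a (a + 2 + 3 * (m - 1))"
      by (rule generates_append_pairs) simp
    then have "generates k P m a (a + k - 2)"
      by (rule generates_eq) (use 1 in simp_all)
    then show ?thesis by blast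
  next
    case 2
    show ?thesis
    proof (cases "\<exists>a. \<not> sink a \<and> \<not> sink (Suc a)")
      case True
      then obtain a where "\<not> sink a" "\<not> sink (Suc a)" by blast
      then have "generates k P 1 a (a + 3)"
        by (intro generates_quad) (simp_all add: sink_def)
      then have "generates k P (1 + (m - 1)) a (a + 3 + 3 * (m - 1))"
        by (rule generates_append_pairs) simp
      then have "generates k P m a (a + k - 2)"
        by (rule generates_eq) (use 2 in simp_all)
      then show ?thesis by blast
    next
      case False
      \<comment> \<open>With no two consecutive non-sinks either, sinks alternate around the cycle,
        so \<open>k\<close> is even. As \<open>m = 1\<close> would mean \<open>k = 5\<close>, two
        triples fit.\<close>
      then have alt: "sink (Suc i) \<longleftrightarrow> \<not> sink i" for i using sink_adj[of i] by auto
      have par: "sink (i + j) \<longleftrightarrow> (sink i \<longleftrightarrow> even j)" for i j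
        by (induction j) (simp_all add: alt)
      have "sink k = sink 0" using per[of 0] per[of 1] by (simp add: sink_def)
      then have "even k" using par[of 0 k] by auto
      with 2 have m: "m \<ge> 2" by (cases "m = 1") auto
      obtain a where a: "\<not> sink a" using sink_adj by blast
      \<comment> \<open>The triples starting at \<open>a\<close> and \<open>a + 4\<close> leave out
        only \<open>a + 3\<close> between them: two generators cover seven positions, whereas two
        pairs with a gap cover five.\<close>
      then have a4: "\<not> sink (a + 4)" using par[of a 4] by simp
      have "generates k P 1 a (a + 2)"
        by (rule generates_triple) (use a in \<open>simp add: sink_def\<close>)
      moreover have "generates k P 1 (a + 4) (a + 4 + 2)"
        by (rule generates_triple) (use a4 in \<open>simp add: sink_def\<close>)
      then have "generates k P 1 (a + 2 + 2) (a + 4 + 2)"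
        by (rule generates_eq) simp_all
      ultimately have "generates k P (1 + 1) a (a + 4 + 2)"
        by (rule generates_join) simp_all
      then have "generates k P (1 + 1 + (m - 2)) a (a + 4 + 2 + 3 * (m - 2))"
        by (rule generates_append_pairs) simp
      then have "generates k P m a (a + k - 2)"
        by (rule generates_eq) (use 2 m in simp_all)
      then show ?thesis by blast
    qed
  qed
  then obtain a where "generates k P m a (a + k - 2)" by blast
  moreover have "k \<ge> 2" using k by simp
  ultimately show ?thesis
    unfolding m_def by (rule generates_all)
qed

subsection \<open>The upper bound\<close>

text \<open>Embeddings of the cycle, that is, labelled copies. Extensional functions are taken so
  that their set is finite.\<close>

definition cycle_homs :: "('a \<Rightarrow> 'a \<Rightarrow> bool) \<Rightarrow> 'a set \<Rightarrow> nat \<Rightarrow> (nat \<Rightarrow> 'a) set" where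
  "cycle_homs E V k =
     {f \<in> {..<k} \<rightarrow>\<^sub>E V. inj_on f {..<k} \<and> (\<forall>i<k. E (f i) (f ((i + 1) mod k)))}"

text \<open>A homomorphism is encoded by the orientation of the cycle, its values on a generating set for
  that orientation, and the index of the head of each edge among the out-neighbours of its tail.\<close>

lemma card_cycle_homs_le:
  fixes E :: "'a \<Rightarrow> 'a \<Rightarrow> bool"
  assumes k: "k \<ge> 5" and V: "finite V" "V \<noteq> {}" and E: "symp E"
    and C4: "\<And>a b c d. E a b \<Longrightarrow> E b c \<Longrightarrow> E c d \<Longrightarrow> E d a \<Longrightarrow> a \<noteq> c \<Longrightarrow> b = d"
    and out: "\<And>x y. E x y \<Longrightarrow> y \<in> out x \<or> x \<in> out y"
    and D: "\<And>x. finite (out x)" "\<And>x. card (out x) \<le> D"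
  shows "card (cycle_homs E V k) \<le> 2 ^ k * D ^ k * card V ^ (k div 3)"
proof -
  have "\<exists>S. S \<subseteq> {..<k} \<and> card S \<le> k div 3 \<and>
      (\<forall>T. closed_under k (\<lambda>i. i mod k \<in> \<sigma>) T \<longrightarrow> S \<subseteq> T \<longrightarrow> T = UNIV)" for \<sigma>
    by (intro cycle_generating_set k) simp
  then obtain S where S: "\<And>\<sigma>. S \<sigma> \<subseteq> {..<k}" "\<And>\<sigma>. card (S \<sigma>) \<le> k div 3"
      "\<And>\<sigma> T. closed_under k (\<lambda>i. i mod k \<in> \<sigma>) T \<Longrightarrow> S \<sigma> \<subseteq> T \<Longrightarrow> T = UNIV"
    by metis
  have "\<exists>l. inj_on l (out x) \<and> l ` out x \<subseteq> {..<D}" for x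
  proof -
    obtain l :: "'a \<Rightarrow> nat" and n where l: "l ` out x = {i. i < n}" "inj_on l (out x)"
      using finite_imp_inj_to_nat_seg[OF D(1)[of x]] by blast
    then have "n \<le> D" using D(2)[of x] card_image[OF l(2)] by simp
    with l show ?thesis by (intro exI[of _ l]) auto
  qed
  then obtain lab where lab: "\<And>x. inj_on (lab x) (out x)" "\<And>x. lab x ` out x \<subseteq> {..<D}"
    by metis
  define nxt where "nxt = (\<lambda>i. (i + 1) mod k)"
  define ori where "ori = (\<lambda>f. {i. i < k \<and> f (nxt i) \<in> out (f i)})"
  define lb where "lb = (\<lambda>f. \<lambda>i\<in>{..<k}. if i \<in> ori f then lab (f i) (f (nxt i)) else lab (f (nxt i)) (f i))"
  define code where "code = (\<lambda>f. (ori f, restrict f (S (ori f)), lb f))"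
  define C where "C = (SIGMA \<sigma>:Pow {..<k}. (S \<sigma> \<rightarrow>\<^sub>E V) \<times> ({..<k} \<rightarrow>\<^sub>E {..<D}))"
  have nextk: "nxt i < k" for i using k by (simp add: nxt_def)
  have homD: "f i \<in> V" "E (f i) (f (nxt i))" "inj_on f {..<k}" if "f \<in> cycle_homs E V k" "i < k" for f i
    using that by (auto simp: cycle_homs_def nxt_def)
  have oriD: "f (nxt i) \<in> out (f i)" if "i \<in> ori f" for f i
    using that by (simp add: ori_def)
  have bwd: "f i \<in> out (f (nxt i))" if "f \<in> cycle_homs E V k" "i < k" "i \<notin> ori f" for f i
    using out[OF homD(2)[OF that(1,2)]] that by (auto simp: ori_def)
  have "code ` cycle_homs E V k \<subseteq> C"
  proof
    fix c assume "c \<in> code ` cycle_homs E V k"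
    then obtain f where f: "f \<in> cycle_homs E V k" "c = code f" by blast
    have "ori f \<in> Pow {..<k}" by (auto simp: ori_def)
    moreover have "restrict f (S (ori f)) \<in> S (ori f) \<rightarrow>\<^sub>E V"
      using homD(1)[OF f(1)] S(1)[of "ori f"] by auto
    moreover have "lb f \<in> {..<k} \<rightarrow>\<^sub>E {..<D}"
      using bwd[OF f(1)] lab(2) by (auto simp: lb_def ori_def PiE_iff image_subset_iff)
    ultimately show "c \<in> C" by (simp add: C_def f(2) code_def)
  qed
  moreover have "inj_on code (cycle_homs E V k)"
  proof (rule inj_onI)
    fix f g assume fg: "f \<in> cycle_homs E V k" "g \<in> cycle_homs E V k" "code f = code g"
    have o: "ori g = ori f" and r: "restrict f (S (ori f)) = restrict g (S (ori f))" and l: "lb f = lb g"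
      using fg(3) by (auto simp: code_def)
    \<comment> \<open>The positions at which two homomorphisms with the same code agree form a
      closed set containing the generating set, hence all positions.\<close>
    define T where "T = {i. f (i mod k) = g (i mod k)}"
    have nx: "nxt (i mod k) = Suc i mod k" for i by (simp add: nxt_def mod_Suc_eq)
    have li: "lb f (i mod k) = lb g (i mod k)" for i using l by simp
    have ik: "i mod k < k" for i using k by simp
    have "closed_under k (\<lambda>i. i mod k \<in> ori f) T"
      unfolding closed_under_def
    proof (intro conjI allI impI)
      fix i
      let ?i = "i mod k"
      show "Suc i \<in> T" if "i \<in> T" "?i \<in> ori f"
      proof -
        have eq: "f ?i = g ?i" using that by (simp add: T_def)
        have "f (nxt ?i) \<in> out (f ?i)" "g (nxt ?i) \<in> out (f ?i)"
          using oriD[of ?i f] oriD[of ?i g] that(2) unfolding o eq by simp_all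
        moreover have "lab (f ?i) (f (nxt ?i)) = lab (f ?i) (g (nxt ?i))"
          using li[of i] that(2) ik[of i] unfolding lb_def o by (simp add: eq)
        ultimately have "f (nxt ?i) = g (nxt ?i)" using inj_onD[OF lab(1)] by metis
        then show ?thesis by (simp add: T_def nx)
      qed
      show "i \<in> T" if "Suc i \<in> T" "?i \<notin> ori f"
      proof -
        have eq: "f (nxt ?i) = g (nxt ?i)" using that by (simp add: T_def nx)
        have "f ?i \<in> out (f (nxt ?i))" "g ?i \<in> out (f (nxt ?i))"
          using bwd[OF fg(1) ik that(2)] bwd[OF fg(2) ik] that(2) unfolding o eq by simp_all
        moreover have "lab (f (nxt ?i)) (f ?i) = lab (f (nxt ?i)) (g ?i)"
          using li[of i] that(2) ik[of i] unfolding lb_def o by (simp add: eq)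
        ultimately have "f ?i = g ?i" using inj_onD[OF lab(1)] by metis
        then show ?thesis by (simp add: T_def)
      qed
      show "Suc i \<in> T" if "i \<in> T" "Suc (Suc i) \<in> T"
      proof -
        let ?j = "nxt ?i" let ?l = "nxt ?j"
        have l: "?l = Suc (Suc i) mod k" unfolding nx ..
        have eq: "f ?i = g ?i" "f ?l = g ?l" using that by (simp_all add: T_def l)
        \<comment> \<open>Positions \<open>i\<close> and \<open>i + 2\<close> differ modulo
          \<open>k\<close>, so by injectivity the two neighbours of position \<open>i + 1\<close> on
          the cycle are distinct, as \<open>C4\<close> demands.\<close>
        have "?i \<noteq> ?l"
        proof
          assume "?i = ?l"
          then have "(i + 2) mod k = i mod k" using l by simp
          then have "k dvd 2" using mod_eq_dvd_iff_nat[of i "i + 2" k] by simp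
          then show False using k by (auto dest: dvd_imp_le)
        qed
        then have "f ?i \<noteq> f ?l"
          using inj_onD[OF homD(3)[OF fg(1) ik], of ?i ?l] ik nextk by blast
        moreover have "E (f ?i) (f ?j)" "E (f ?j) (f ?l)"
          by (rule homD(2)[OF fg(1) ik], rule homD(2)[OF fg(1) nextk])
        moreover have "E (f ?l) (g ?j)"
          unfolding eq by (rule sympD[OF E homD(2)[OF fg(2) nextk]])
        moreover have "E (g ?j) (f ?i)"
          unfolding eq by (rule sympD[OF E homD(2)[OF fg(2) ik]])
        ultimately have "f ?j = g ?j" by (intro C4[of "f ?i" "f ?j" "f ?l" "g ?j"])
        then show ?thesis by (simp add: T_def nx)
      qed
    qed (simp_all add: T_def)
    moreover have "S (ori f) \<subseteq> T"
    proof
      fix s assume s: "s \<in> S (ori f)"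
      then have "s < k" using S(1) by blast
      moreover have "f s = g s" using fun_cong[OF r, of s] s by simp
      ultimately show "s \<in> T" by (simp add: T_def)
    qed
    ultimately have "T = UNIV" by (rule S(3))
    then have "f i = g i" if "i < k" for i
    proof -
      have "i \<in> T" using \<open>T = UNIV\<close> by simp
      then show ?thesis using that by (simp add: T_def)
    qed
    moreover have "f \<in> extensional {..<k}" "g \<in> extensional {..<k}"
      using fg(1,2) by (simp_all add: cycle_homs_def PiE_def)
    ultimately show "f = g" by (intro extensionalityI[of f "{..<k}" g]) auto
  qed
  moreover have finS: "finite (S \<sigma>)" for \<sigma> using S(1) finite_subset by blast
  have "finite C"
    unfolding C_def using V(1) finS by (intro finite_SigmaI finite_cartesian_product finite_PiE) auto
  ultimately have "card (cycle_homs E V k) \<le> card C"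
    by (meson card_inj_on_le)
  also have "\<dots> = (\<Sum>\<sigma>\<in>Pow {..<k}. card V ^ card (S \<sigma>) * D ^ k)"
    unfolding C_def using V(1) finS
    by (subst card_SigmaI) (auto simp: card_cartesian_product card_PiE intro!: finite_cartesian_product finite_PiE)
  \<comment> \<open>Raising the exponent from \<open>card (S \<sigma>)\<close> to
    \<open>k div 3\<close> relies on \<open>V\<close> being nonempty.\<close>
  also have "\<dots> \<le> (\<Sum>\<sigma>\<in>Pow {..<k}. card V ^ (k div 3) * D ^ k)"
    using S(2) V by (intro sum_mono mult_right_mono power_increasing) (auto simp: Suc_le_eq card_gt_0_iff)
  also have "\<dots> = 2 ^ k * D ^ k * card V ^ (k div 3)"
    by (simp add: card_Pow)
  finally show ?thesis .
qed

lemma edges_cycle_graph: "edges (cycle_graph k) = (\<lambda>i. {i, (i + 1) mod k}) ` {..<k}"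
  by (auto simp: cycle_graph_def)

lemma finite_copies: "finite (verts G) \<Longrightarrow> finite (copies H G)"
proof -
  assume fin: "finite (verts G)"
  have "copies H G \<subseteq> Pow (verts G) \<times> Pow (Pow (verts G))"
  proof
    fix S assume "S \<in> copies H G"
    then have "verts S \<subseteq> verts G" "\<forall>e\<in>edges S. e \<subseteq> verts S"
      by (simp_all add: copies_def subgraph_def simple_graph_def)
    then show "S \<in> Pow (verts G) \<times> Pow (Pow (verts G))" by (cases S) auto
  qed
  then show ?thesis using fin by (auto intro: finite_subset)
qed

text \<open>Each copy is the image of an embedding under \<open>\<Phi>\<close>. Several embeddings
  may share an image, which is harmless for an upper bound.\<close>

lemma card_copies_cycle_le:
  assumes fin: "finite (verts G)" and k: "k \<ge> 1"
  shows "card (copies (cycle_graph k) G) \<le> card (cycle_homs (vadj G) (verts G) k)"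
proof -
  let ?H = "cycle_homs (vadj G) (verts G) k"
  define \<Phi> :: "(nat \<Rightarrow> 'a) \<Rightarrow> 'a ugraph"
    where "\<Phi> = (\<lambda>f. (f ` {..<k}, (\<lambda>i. {f i, f ((i + 1) mod k)}) ` {..<k}))"
  have "copies (cycle_graph k) G \<subseteq> \<Phi> ` ?H"
  proof
    fix S assume "S \<in> copies (cycle_graph k) G"
    then have S: "verts S \<subseteq> verts G" "edges S \<subseteq> edges G" and iso: "graph_iso (cycle_graph k) S"
      by (simp_all add: copies_def subgraph_def)
    have "verts (cycle_graph k) = {..<k}" by (simp add: cycle_graph_def)
    with iso obtain f where
      f: "bij_betw f {..<k} (verts S)" "(\<lambda>e. f ` e) ` edges (cycle_graph k) = edges S"
      unfolding graph_iso_def by metis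
    have next_lt: "(i + 1) mod k < k" for i using k by simp
    let ?g = "restrict f {..<k}"
    have E: "edges S = (\<lambda>i. {f i, f ((i + 1) mod k)}) ` {..<k}"
      unfolding f(2)[symmetric] edges_cycle_graph image_image by simp
    have gf: "(\<lambda>i. {?g i, ?g ((i + 1) mod k)}) ` {..<k} = (\<lambda>i. {f i, f ((i + 1) mod k)}) ` {..<k}"
      using next_lt by (intro image_cong) simp_all
    have "\<Phi> ?g = (verts S, edges S)"
      unfolding \<Phi>_def gf E using f(1) by (simp add: bij_betw_def)
    moreover have "?g \<in> ?H"
    proof -
      have "?g \<in> {..<k} \<rightarrow>\<^sub>E verts G" using f(1) S(1) by (auto simp: bij_betw_def)
      moreover have "inj_on ?g {..<k}" using f(1) by (simp add: bij_betw_def)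
      moreover have "vadj G (?g i) (?g ((i + 1) mod k))" if "i < k" for i
      proof -
        have "{f i, f ((i + 1) mod k)} \<in> edges G" using S(2) that unfolding E by auto
        then show ?thesis using that next_lt[of i] by (simp add: vadj_def)
      qed
      ultimately show ?thesis by (simp add: cycle_homs_def)
    qed
    ultimately show "S \<in> \<Phi> ` ?H" by (metis imageI prod.collapse)
  qed
  moreover have "finite ?H"
    using fin by (auto simp: cycle_homs_def intro: finite_subset[OF _ finite_PiE[of "{..<k}" "\<lambda>_. verts G"]])
  ultimately show ?thesis by (meson card_image_le card_mono finite_imageI le_trans)
qed

lemma edges_C4: "edges (cycle_graph 4) = {{0, 1}, {1, 2}, {2, 3}, {3, 0}}"
proof -
  have "{..<4} = {0, 1, 2, 3 :: nat}" by auto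
  then show ?thesis unfolding edges_cycle_graph by (simp del: One_nat_def)
qed

lemma C4_free_common_nbr:
  assumes G: "simple_graph G" and free: "\<not> contains G (cycle_graph 4)"
    and adj: "vadj G a b" "vadj G b c" "vadj G c d" "vadj G d a" and "a \<noteq> c"
  shows "b = d"
proof (rule ccontr)
  assume "b \<noteq> d"
  let ?V = "{a, b, c, d}" and ?E = "{{a, b}, {b, c}, {c, d}, {d, a}}"
  have e: "e \<subseteq> verts G \<and> card e = 2" if "e \<in> ?E" for e
    using that adj G by (auto simp: vadj_def simple_graph_def)
  have ne: "a \<noteq> b" "b \<noteq> c" "c \<noteq> d" "d \<noteq> a"
    using e[of "{a, b}"] e[of "{b, c}"] e[of "{c, d}"] e[of "{d, a}"] by auto
  have "simple_graph (?V, ?E)"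
    using e by (auto simp: simple_graph_def)
  moreover have "?V \<subseteq> verts G" using e by auto
  moreover have "?E \<subseteq> edges G" using adj by (simp add: vadj_def)
  ultimately have "subgraph (?V, ?E) G" by (simp add: subgraph_def)
  moreover have "graph_iso (cycle_graph 4) (?V, ?E)"
  proof -
    define f where "f = (\<lambda>i :: nat. [a, b, c, d] ! i)"
    have s: "{..<4} = {0, 1, 2, 3 :: nat}" by auto
    have fs: "f 0 = a" "f 1 = b" "f 2 = c" "f 3 = d" by (simp_all add: f_def numeral_2_eq_2 numeral_3_eq_3)
    have "bij_betw f {..<4} ?V"
      unfolding s bij_betw_def inj_on_def using fs ne \<open>b \<noteq> d\<close> \<open>a \<noteq> c\<close> by simp
    moreover have "(\<lambda>e. f ` e) ` edges (cycle_graph 4) = ?E"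
      unfolding edges_C4 using fs by simp
    ultimately show ?thesis
      unfolding graph_iso_def by (intro exI[of _ f]) (simp add: cycle_graph_def)
  qed
  ultimately have "(?V, ?E) \<in> copies (cycle_graph 4) G" by (simp add: copies_def)
  with free show False by (auto simp: contains_def)
qed

lemma planar_free_graphs_C4_nonempty: "planar_free_graphs n {cycle_graph 4} \<noteq> {}"
  by (rule planar_free_graphs_nonempty) (simp add: edges_C4)

lemma ex_planar_cycle_le:
  assumes k: "k \<ge> 5" and n: "n \<ge> 1"
  shows "ex_planar n (cycle_graph k) {cycle_graph 4} \<le> 2 ^ k * (4 ^ 6) ^ k * n ^ (k div 3)"
  unfolding ex_planar_def
proof (rule Max.boundedI[OF finite_copies_counts])
  show "(\<lambda>G. card (copies (cycle_graph k) G)) ` planar_free_graphs n {cycle_graph 4} \<noteq> {}"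
    using planar_free_graphs_C4_nonempty by blast
  fix x assume "x \<in> (\<lambda>G. card (copies (cycle_graph k) G)) ` planar_free_graphs n {cycle_graph 4}"
  then obtain G where "G \<in> planar_free_graphs n {cycle_graph 4}" and x: "x = card (copies (cycle_graph k) G)"
    by blast
  then have G: "simple_graph G" "card (verts G) = n" "planar G" "\<not> contains G (cycle_graph 4)"
    by (simp_all add: planar_free_graphs_def)
  have fin: "finite (verts G)" and ne: "verts G \<noteq> {}"
    using G n by (auto simp: simple_graph_def)
  obtain out where out: "\<forall>x y. {x, y} \<in> edges G \<longrightarrow> y \<in> out x \<or> x \<in> out y"
      "\<forall>x. finite (out x) \<and> card (out x) \<le> 4 ^ 6"
    using planar_orientation[OF G(1,3)] by blast
  have "card (cycle_homs (vadj G) (verts G) k) \<le> 2 ^ k * (4 ^ 6) ^ k * card (verts G) ^ (k div 3)"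
  proof (rule card_cycle_homs_le[OF k fin ne])
    show "symp (vadj G)" by (simp add: symp_def vadj_def insert_commute)
    show "b = d" if "vadj G a b" "vadj G b c" "vadj G c d" "vadj G d a" "a \<noteq> c" for a b c d
      using C4_free_common_nbr[OF G(1,4) that] .
    show "y \<in> out x \<or> x \<in> out y" if "vadj G x y" for x y
      using that out(1) by (simp add: vadj_def)
  qed (use out(2) in auto)
  moreover have "card (copies (cycle_graph k) G) \<le> card (cycle_homs (vadj G) (verts G) k)"
    using card_copies_cycle_le[OF fin] k by simp
  ultimately show "x \<le> 2 ^ k * (4 ^ 6) ^ k * n ^ (k div 3)"
    using x G(2) by simp
qed

subsection \<open>The lower bound\<close>

text \<open>Vertex \<open>v\<close> lies in column \<open>v mod k\<close> on level \<open>v div k\<close>. The thick columns come in pairs and carry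
  the bundles of parallel paths; of the other columns only level 0 is used, and the remaining
  vertices are isolated.\<close>

locale bundle_graph =
  fixes k n :: nat
  assumes k: "k \<ge> 5"
begin

definition m where "m = k div 3"

definition col :: "nat \<Rightarrow> nat" where "col v = v mod k"

definition level :: "nat \<Rightarrow> nat" where "level v = v div k"

definition nxt :: "nat \<Rightarrow> nat" where "nxt c = (if c + 1 = k then 0 else c + 1)"

text \<open>Columns \<open>3 * t + 1\<close> and \<open>3 * t + 2\<close> with \<open>t < m\<close>
  hold the inner vertices of the parallel paths in bundle \<open>t\<close>. Its ends are in the
  columns \<open>3 * t\<close> and \<open>3 * t + 3\<close>, the latter being column 0 if it equals
  \<open>k\<close>.\<close>

definition thick :: "nat \<Rightarrow> bool" where "thick c \<longleftrightarrow> c < 3 * m \<and> c mod 3 \<noteq> 0"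

definition valid :: "nat \<Rightarrow> bool" where "valid v \<longleftrightarrow> v < n \<and> (thick (col v) \<or> level v = 0)"

definition step :: "nat \<Rightarrow> nat \<Rightarrow> bool" where
  "step u v \<longleftrightarrow> valid u \<and> valid v \<and> col v = nxt (col u) \<and>
     (thick (col u) \<and> thick (col v) \<longrightarrow> level u = level v)"

definition bundled :: "nat ugraph" where
  "bundled = ({..<n}, {e. \<exists>u v. step u v \<and> e = {u, v}})"

section \<open>Column arithmetic and the exclusion of four-cycles\<close>

lemma m: "3 * m \<le> k" "m \<ge> 1"
  using k unfolding m_def by linarith+

lemma col_lt: "col v < k"
  using k by (simp add: col_def)

lemma vertex_eqI: "col u = col v \<Longrightarrow> level u = level v \<Longrightarrow> u = v"
  by (metis col_def level_def div_mult_mod_eq)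

lemma nxt_lt: "c < k \<Longrightarrow> nxt c < k"
  by (auto simp: nxt_def)

lemma nxt_eq_mod: "c < k \<Longrightarrow> (c + 1) mod k = nxt c"
  by (auto simp: nxt_def)

lemma nxt_inj: "nxt c = nxt c' \<Longrightarrow> c < k \<Longrightarrow> c' < k \<Longrightarrow> c = c'"
  by (auto simp: nxt_def split: if_splits)

text \<open>Each edge moves by one column, so a closed walk of four edges has a total displacement
  of 0, 2 or 4 up to sign. As \<open>k \<ge> 5\<close>, neither 2 nor 4 vanishes modulo
  \<open>k\<close>, which leaves 0.\<close>

lemma nxt_ne: "c < k \<Longrightarrow> nxt c \<noteq> c" "c < k \<Longrightarrow> nxt (nxt c) \<noteq> c" "c < k \<Longrightarrow> nxt (nxt (nxt (nxt c))) \<noteq> c"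
  using k by (auto simp: nxt_def split: if_splits)

text \<open>The reason why there is no C_4: a thick column never lies between two thin ones, where
  its vertices would be common neighbours of the two junctions.\<close>

lemma thick_pair: "thick (nxt c) \<Longrightarrow> thick c \<or> thick (nxt (nxt c))"
proof -
  assume i: "thick (nxt c)"
  then have s: "nxt c = c + 1" "c + 1 < 3 * m" "(c + 1) mod 3 \<noteq> 0"
    by (auto simp: thick_def nxt_def split: if_splits)
  show ?thesis
  proof (cases "(c + 1) mod 3 = 1")
    case True
    then have "(c + 2) mod 3 \<noteq> 0" "c + 2 < 3 * m" using s(2) by presburger+
    moreover from this have "nxt (nxt c) = c + 2" using m(1) unfolding s(1) by (simp add: nxt_def)
    ultimately show ?thesis by (simp add: thick_def)
  next
    case False
    then have "c mod 3 \<noteq> 0" using s(3) by presburger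
    then show ?thesis using s(2) by (simp add: thick_def)
  qed
qed

lemma step_ne: "step u v \<Longrightarrow> u \<noteq> v"
  using nxt_ne(1)[OF col_lt, of u] by (auto simp: step_def)

lemma simple_bundled: "simple_graph bundled"
proof -
  have "{u, v} \<subseteq> {..<n} \<and> card {u, v} = 2" if "step u v" for u v
    using that step_ne[OF that] by (auto simp: step_def valid_def)
  then show ?thesis by (auto simp: simple_graph_def bundled_def)
qed

lemma edge_bundled: "{u, v} \<in> edges bundled \<longleftrightarrow> step u v \<or> step v u"
  by (auto simp: bundled_def doubleton_eq_iff)

text \<open>Distinct vertices of one column differ in level. A thin column has level 0 only, so
  \<open>b\<close> and \<open>d\<close> lie in a thick one; were \<open>a\<close> in a thick column
  too, it would prescribe their level.\<close>

lemma step_det: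
  assumes "step a b" "step a d" "b \<noteq> d"
  shows "\<not> thick (col a)" "thick (col b)" "col d = col b"
proof -
  show c: "col d = col b" using assms by (simp add: step_def)
  then have r: "level b \<noteq> level d" using assms(3) vertex_eqI by metis
  show "thick (col b)" using r c assms(1,2) by (auto simp: step_def valid_def)
  then show "\<not> thick (col a)" using r c assms(1,2) by (auto simp: step_def)
qed

lemma step_det':
  assumes "step b a" "step d a" "b \<noteq> d"
  shows "\<not> thick (col a)" "thick (col b)" "col d = col b"
proof -
  show c: "col d = col b" using assms nxt_inj[OF _ col_lt col_lt] by (auto simp: step_def)
  then have r: "level b \<noteq> level d" using assms(3) vertex_eqI by metis
  show "thick (col b)" using r c assms(1,2) by (auto simp: step_def valid_def)
  then show "\<not> thick (col a)" using r c assms(1,2) by (auto simp: step_def)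
qed

lemma stepD:
  assumes "step u v"
  shows "col v = nxt (col u)" "thick (col u) \<Longrightarrow> thick (col v) \<Longrightarrow> level u = level v"
    "\<not> thick (col u) \<Longrightarrow> level u = 0" "\<not> thick (col v) \<Longrightarrow> level v = 0"
  using assms unfolding step_def valid_def by blast+

lemma junction_unique:
  "step u v \<Longrightarrow> step u' v' \<Longrightarrow> \<not> thick (col u) \<Longrightarrow> col u = col u' \<Longrightarrow> u = u'"
  "step u v \<Longrightarrow> step u' v' \<Longrightarrow> \<not> thick (col v) \<Longrightarrow> col v = col v' \<Longrightarrow> v = v'"
  by (metis stepD(3) vertex_eqI, metis stepD(4) vertex_eqI)

text \<open>If \<open>b\<close>, \<open>c\<close>, \<open>d\<close> is a second directed path beside
  \<open>b\<close>, \<open>a\<close>, \<open>d\<close>, then the column of \<open>a\<close> is thick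
  between two thin ones. Any other directions at \<open>c\<close> give the four edges a total
  displacement of 2 or 4.\<close>

lemma no_C4_through:
  assumes "step b a" "step a d" "step b c \<or> step c b" "step c d \<or> step d c" "a \<noteq> c"
  shows False
proof -
  have cb: "col a = nxt (col b)" "col d = nxt (col a)" using assms(1,2) by (simp_all add: step_def)
  show False
  proof (cases "step b c"; cases "step c d")
    assume bc: "step b c" and cd: "step c d"
    have "thick (col a)" "\<not> thick (col b)" using step_det[OF assms(1) bc assms(5)] by auto
    moreover have "\<not> thick (col d)" using step_det'[OF assms(2) cd assms(5)] by auto
    ultimately show False using thick_pair[of "col b"] cb by simp
  next
    assume "step b c" "\<not> step c d"
    then have "col c = col a" "col c = nxt (col d)" using assms(4) cb stepD(1) by metis+
    then have "nxt (nxt (col a)) = col a" using cb by simp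
    then show False using nxt_ne(2)[OF col_lt] by blast
  next
    assume "\<not> step b c" "step c d"
    then have "col b = nxt (col c)" "nxt (col c) = nxt (col a)" using assms(3) stepD(1) cb by metis+
    then have "nxt (nxt (col a)) = nxt (col b)" by simp
    then have "nxt (nxt (col a)) = col a" using cb by simp
    then show False using nxt_ne(2)[OF col_lt] by blast
  next
    assume "\<not> step b c" "\<not> step c d"
    then have "col b = nxt (col c)" "col c = nxt (col d)" using assms(3,4) stepD(1) by blast+
    then have "nxt (nxt (nxt (nxt (col b)))) = col b" using cb by metis
    then show False using nxt_ne(3)[OF col_lt] by blast
  qed
qed

text \<open>The cases are the directions of the two edges at \<open>a\<close>. If both leave
  \<open>a\<close> or both enter it, then \<open>a\<close> is a junction and \<open>b\<close>,
  \<open>d\<close> share a thick column. An opposite vertex \<open>c\<close> on the same side as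
  \<open>a\<close> would be the same junction, and on the other side it would be a junction as well,
  contrary to \<open>thick_pair\<close>.\<close>

lemma no_C4:
  assumes ab: "step a b \<or> step b a" and bc: "step b c \<or> step c b" and cd: "step c d \<or> step d c"
    and da: "step d a \<or> step a d" and ac: "a \<noteq> c"
  shows "b = d"
proof (rule ccontr)
  assume bd: "b \<noteq> d"
  consider "step a b" "step a d" | "step b a" "step d a" | "step b a" "step a d" | "step d a" "step a b"
    using ab da by blast
  then show False
  proof cases
    case 1
    note s = step_det[OF 1 bd]
    show False
    proof (cases "step c b")
      case True
      then have "col a = col c" using stepD(1)[OF 1(1)] stepD(1)[OF True] nxt_inj[OF _ col_lt col_lt] by metis
      then show False using junction_unique(1)[OF 1(1) True s(1)] ac by simp
    next
      case False
      then have bc: "step b c" using bc by blast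
      have "\<not> step c d"
      proof
        assume "step c d"
        then have "nxt (nxt (col b)) = col b" using s(3) bc stepD(1) by metis
        then show False using nxt_ne(2)[OF col_lt] by blast
      qed
      then have "step d c" using cd by blast
      then have "\<not> thick (col c)" using step_det'[OF bc _ bd] by simp
      then show False using s(1,2) thick_pair[of "col a"] stepD(1)[OF 1(1)] stepD(1)[OF bc] by metis
    qed
  next
    case 2
    note s = step_det'[OF 2 bd]
    show False
    proof (cases "step b c")
      case True
      then have "col a = col c" using stepD(1)[OF 2(1)] stepD(1)[OF True] by metis
      then show False using junction_unique(2)[OF 2(1) True s(1)] ac by simp
    next
      case False
      then have bc: "step c b" using bc by blast
      have "\<not> step d c"
      proof
        assume "step d c"
        then have "nxt (nxt (col b)) = col b" using s(3) bc stepD(1) by metis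
        then show False using nxt_ne(2)[OF col_lt] by blast
      qed
      then have "step c d" using cd by blast
      then have "\<not> thick (col c)" using step_det[OF bc _ bd] by simp
      then show False using s(1,2) thick_pair[of "col c"] stepD(1)[OF 2(1)] stepD(1)[OF bc] by metis
    qed
  next
    case 3
    then show False using no_C4_through[OF 3] bc cd ac by blast
  next
    case 4
    then show False using no_C4_through[OF 4] bc cd ac by blast
  qed
qed

text \<open>Columns 3, ..., \<open>k\<close> (column \<open>k\<close> being column 0) are drawn on and above the real axis at their own
  abscissa; columns 1 and 2 carry a bundle that returns from \<open>k\<close> to 3 below the axis.\<close>

definition xpos :: "nat \<Rightarrow> real" where
  "xpos v = (if col v = 0 then real k else if col v = 1 then real k - 1 / 2
     else if col v = 2 then 7 / 2 else real (col v))"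

text \<open>The additional 1 keeps columns 1 and 2 strictly below the axis, even on level 0.\<close>

definition ypos :: "nat \<Rightarrow> real" where
  "ypos v = (if col v \<in> {1, 2} then - (real (level v) + 1) else real (level v))"

definition pos :: "nat \<Rightarrow> complex" where "pos v = Complex (xpos v) (ypos v)"

section \<open>Coordinates along the drawn segments and their separation\<close>

definition xseg :: "nat \<Rightarrow> nat \<Rightarrow> real \<Rightarrow> real" where "xseg u v t = (1 - t) * xpos u + t * xpos v"

definition yseg :: "nat \<Rightarrow> nat \<Rightarrow> real \<Rightarrow> real" where "yseg u v t = (1 - t) * ypos u + t * ypos v"

lemma pos_cases:
  obtains (upper) c :: nat where "3 \<le> c" "c \<le> k" "xpos v = real c" "ypos v = real (level v)" "col v = (if c = k then 0 else c)"
  | (right) "col v = 1" "xpos v = real k - 1 / 2" "ypos v = - (real (level v) + 1)"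
  | (left) "col v = 2" "xpos v = 7 / 2" "ypos v = - (real (level v) + 1)"
proof -
  consider "col v = 0" | "col v = 1" | "col v = 2" | "3 \<le> col v" by linarith
  then show thesis
  proof cases
    case 1
    then show ?thesis using upper[of k] k by (simp add: xpos_def ypos_def)
  next
    case 4
    then show ?thesis using upper[of "col v"] col_lt[of v] by (simp add: xpos_def ypos_def)
  qed (use right left in \<open>simp_all add: xpos_def ypos_def\<close>)
qed

lemma of_nat_unit_interval:
  fixes a b :: nat and s t :: real
  assumes "real a + s = real b + t" "0 \<le> s" "s < 1" "0 \<le> t" "t < 1"
  shows "a = b"
proof -
  have "real a < real (b + 1)" "real b < real (a + 1)"
    using assms by simp_all
  then have "a < b + 1" "b < a + 1"
    by (simp_all only: of_nat_less_iff)
  then show ?thesis by simp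
qed

lemma k5: "real k \<ge> 5"
  using k by simp

lemma pos_inj:
  assumes "xpos u = xpos v" "ypos u = ypos v"
  shows "u = v"
proof (cases u rule: pos_cases)
  case u: (upper c)
  show ?thesis
  proof (cases v rule: pos_cases)
    case v: (upper c')
    have "c = c'" "level u = level v" using u(3,4) v(3,4) assms by simp_all
    then show ?thesis using u(5) v(5) by (intro vertex_eqI[of u v]) simp_all
  qed (use u(4) assms in linarith)+
next
  case u: right
  show ?thesis
  proof (cases v rule: pos_cases)
    case v: right
    then have "level u = level v" using u(3) assms by simp
    then show ?thesis using u(1) v(1) by (intro vertex_eqI[of u v]) simp_all
  qed (use u(2,3) assms k5 in linarith)+
next
  case u: left
  show ?thesis
  proof (cases v rule: pos_cases)
    case v: left
    then have "level u = level v" using u(3) assms by simp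
    then show ?thesis using u(1) v(1) by (intro vertex_eqI[of u v]) simp_all
  qed (use u(2,3) assms k5 in linarith)+
qed

lemma thick_1: "thick 1" "thick 2" "\<not> thick 0" "\<not> thick 3"
  using m(2) by (simp_all add: thick_def)

lemma step_cases:
  assumes "step u v"
  obtains (upper) c :: nat where "3 \<le> c" "c < k" "xpos u = real c" "xpos v = real c + 1" "ypos u = real (level u)"
      "ypos v = real (level v)" "col u = c"
      "\<not> thick (col u) \<Longrightarrow> level u = 0" "\<not> thick (col v) \<Longrightarrow> level v = 0"
  | (right) "col u = 0" "level u = 0" "col v = 1" "xpos u = real k" "ypos u = 0" "xpos v = real k - 1 / 2" "ypos v = - (real (level v) + 1)"
  | (low) "col u = 1" "col v = 2" "level u = level v" "xpos u = real k - 1 / 2" "xpos v = 7 / 2"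
      "ypos u = - (real (level v) + 1)" "ypos v = - (real (level v) + 1)"
  | (left) "col u = 2" "col v = 3" "level v = 0" "xpos u = 7 / 2" "xpos v = 3" "ypos u = - (real (level u) + 1)" "ypos v = 0"
proof -
  have s: "col v = nxt (col u)" "thick (col u) \<Longrightarrow> thick (col v) \<Longrightarrow> level u = level v"
      "\<not> thick (col u) \<Longrightarrow> level u = 0" "\<not> thick (col v) \<Longrightarrow> level v = 0"
    using assms by (auto simp: step_def valid_def)
  consider "col u = 0" | "col u = 1" | "col u = 2" | "3 \<le> col u" by linarith
  then show thesis
  proof cases
    case 1
    then have "col v = 1" using s(1) k by (simp add: nxt_def)
    then show ?thesis using right 1 s(3) thick_1 by (simp add: xpos_def ypos_def)
  next
    case 2
    then have "col v = 2" using s(1) k by (simp add: nxt_def)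
    then show ?thesis using low 2 s(2) thick_1 by (simp add: xpos_def ypos_def)
  next
    case 3
    then have "col v = 3" using s(1) k by (simp add: nxt_def)
    then show ?thesis using left 3 s(4) thick_1 by (simp add: xpos_def ypos_def)
  next
    case 4
    have "xpos v = real (col u) + 1" "ypos v = real (level v)"
      using 4 s(1) col_lt[of u] by (auto simp: xpos_def ypos_def nxt_def)
    then show ?thesis using upper[of "col u"] 4 col_lt[of u] s(2,3,4) by (auto simp: xpos_def ypos_def)
  qed
qed

text \<open>Separates the edges by place. The upper ones stay on or above the axis in strips between
  consecutive integers; the others are strictly below it, with abscissae in the disjoint intervals
  from 3 to 7/2, from 7/2 to k - 1/2, and from k - 1/2 to k. So inner points of edges can coincide
  only for edges between the same two columns.\<close>

lemma seg_cases:
  assumes "step u v" "0 < t" "t < 1"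
  obtains (upper) "3 \<le> col u" "xseg u v t = real (col u) + t" "yseg u v t = (1 - t) * real (level u) + t * real (level v)"
      "yseg u v t \<ge> 0"
      "\<not> thick (col u) \<Longrightarrow> level u = 0" "\<not> thick (col v) \<Longrightarrow> level v = 0"
  | (right) "col u = 0" "level u = 0" "col v = 1" "xseg u v t = real k - t / 2" "yseg u v t = - t * (real (level v) + 1)" "yseg u v t < 0"
  | (low) "col u = 1" "col v = 2" "level u = level v" "7 / 2 < xseg u v t" "xseg u v t < real k - 1 / 2"
      "yseg u v t = - (real (level v) + 1)" "yseg u v t < 0"
  | (left) "col u = 2" "col v = 3" "level v = 0" "xseg u v t = 7 / 2 - t / 2" "yseg u v t = - (1 - t) * (real (level u) + 1)" "yseg u v t < 0"
  using assms(1)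
proof (cases rule: step_cases)
  case (upper c)
  have y: "yseg u v t = (1 - t) * real (level u) + t * real (level v)"
    using upper by (simp add: yseg_def)
  show ?thesis
  proof (rule that(1))
    show "xseg u v t = real (col u) + t" using upper by (simp add: xseg_def algebra_simps)
    show "yseg u v t \<ge> 0" unfolding y using assms(2,3) by simp
  qed (use upper y in simp_all)
next
  case right
  have y: "yseg u v t = - t * (real (level v) + 1)"
    unfolding yseg_def right(5,7) by (simp add: algebra_simps)
  show ?thesis
  proof (rule that(2))
    show "xseg u v t = real k - t / 2" unfolding xseg_def right(4,6) by (simp add: algebra_simps)
    show "yseg u v t < 0" unfolding y using assms(2) by (simp add: mult_neg_pos)
  qed (use right y in simp_all)
next
  case low
  have x: "xseg u v t = real k - 1 / 2 - t * (real k - 4)"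
    unfolding xseg_def low(4,5) by (simp add: field_simps)
  have y: "yseg u v t = - (real (level v) + 1)"
    unfolding yseg_def low(6,7) by (simp add: algebra_simps)
  have t: "0 < t * (real k - 4)" "t * (real k - 4) < real k - 4"
    using assms(2,3) k5 by simp_all
  show ?thesis
  proof (rule that(3))
    show "7 / 2 < xseg u v t" "xseg u v t < real k - 1 / 2" using t unfolding x by linarith+
  qed (use low y in simp_all)
next
  case left
  have y: "yseg u v t = - (1 - t) * (real (level u) + 1)"
    unfolding yseg_def left(6,7) by (simp add: algebra_simps)
  show ?thesis
  proof (rule that(4))
    show "xseg u v t = 7 / 2 - t / 2" unfolding xseg_def left(4,5) by (simp add: field_simps)
    show "yseg u v t < 0" unfolding y using assms(3) by (simp add: mult_neg_pos)
  qed (use left y in simp_all)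
qed

lemma seg_avoids_vertices:
  assumes "step u v" "0 < t" "t < 1" "xseg u v t = xpos w" "yseg u v t = ypos w"
  shows False
  using assms(1-3)
proof (cases rule: seg_cases)
  case A: upper
  show ?thesis
  proof (cases w rule: pos_cases)
    case (upper c)
    have e: "real (col u) + t = real c + 0" using assms(4) A(2) upper(3) by simp
    have "col u = c" by (rule of_nat_unit_interval[OF e]) (use assms(2,3) in simp_all)
    with e show False using assms(2) by simp
  qed (use assms(5) A(4) in linarith)+
next
  case A: right
  show ?thesis
    by (cases w rule: pos_cases) (use assms(2-5) A(4,6) k5 in linarith)+
next
  case A: low
  show ?thesis
    by (cases w rule: pos_cases) (use assms(2-5) A(4,5,7) k5 in linarith)+
next
  case A: left
  show ?thesis
    by (cases w rule: pos_cases) (use assms(2-5) A(4,6) k5 in linarith)+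
qed

text \<open>Edges between the same two columns are horizontal if both columns are thick, and
  otherwise a fan whose apex is a junction on level 0, or a single edge. In a fan, equal abscissae
  mean equal parameters, and at an inner parameter equal heights mean equal levels.\<close>

lemma segs_disjoint:
  assumes "step u v" "0 < t" "t < 1" "step u' v'" "0 < t'" "t' < 1"
    and eq: "xseg u v t = xseg u' v' t'" "yseg u v t = yseg u' v' t'"
  shows "u = u' \<and> v = v'"
proof -
  note cv = stepD(1)[OF assms(1)] stepD(1)[OF assms(4)]
  have *: "u = u' \<and> v = v'" if "level u = level u'" "level v = level v'" "col u = col u'"
    using that cv by (simp add: vertex_eqI)
  from assms(1-3) show ?thesis
  proof (cases rule: seg_cases)
    case A: upper
    from assms(4-6) show ?thesis
    proof (cases rule: seg_cases)
      case A': upper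
      have x: "real (col u) + t = real (col u') + t'" using A(2) A'(2) eq by simp
      have c: "col u = col u'" by (rule of_nat_unit_interval[OF x]) (use assms(2,3,5,6) in simp_all)
      then have t: "t = t'" using x by simp
      have cv': "col v = col v'" using c cv by simp
      have e: "(1 - t) * real (level u) + t * real (level v) = (1 - t) * real (level u') + t * real (level v')"
        using A(3) A'(3) eq t by simp
      have "level u = level u' \<and> level v = level v'"
      proof (cases "thick (col u)"; cases "thick (col v)")
        assume "thick (col u)" "thick (col v)"
        then have "level u = level v" "level u' = level v'" using stepD(2) assms(1,4) c cv' by metis+
        with e show ?thesis by (simp add: algebra_simps)
      next
        assume "thick (col u)" "\<not> thick (col v)"
        then have "level v = 0" "level v' = 0" using A(6) A'(6) cv' by simp_all
        with e assms(3) show ?thesis by simp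
      next
        assume "\<not> thick (col u)" "thick (col v)"
        then have "level u = 0" "level u' = 0" using A(5) A'(5) c by simp_all
        with e assms(2) show ?thesis by simp
      next
        assume "\<not> thick (col u)" "\<not> thick (col v)"
        then show ?thesis using A(5,6) A'(5,6) c cv' by simp
      qed
      then show ?thesis using * c by blast
    qed (use eq A(4) in linarith)+
  next
    case A: right
    from assms(4-6) show ?thesis
    proof (cases rule: seg_cases)
      case A': right
      have "t = t'" using A(4) A'(4) eq(1) by simp
      then have "level v = level v'" using A(5) A'(5) eq(2) assms(2) by simp
      then show ?thesis using * A(1,2) A'(1,2) by simp
    qed (use eq A(4,6) assms(2,3,5,6) k5 in linarith)+
  next
    case A: low
    from assms(4-6) show ?thesis
    proof (cases rule: seg_cases)
      case A': low
      have "level v = level v'" using A(6) A'(6) eq by simp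
      then show ?thesis using * A(1,3) A'(1,3) by simp
    qed (use eq A(4,5,7) assms(2,3,5,6) k5 in linarith)+
  next
    case A: left
    from assms(4-6) show ?thesis
    proof (cases rule: seg_cases)
      case A': left
      have "t = t'" using A(4) A'(4) eq(1) by simp
      then have "level u = level u'" using A(5) A'(5) eq(2) assms(3) by simp
      then show ?thesis using * A(1,3) A'(1,3) by simp
    qed (use eq A(4,6) assms(2,3,5,6) k5 in linarith)+
  qed
qed

lemma in_segment_pos:
  "z \<in> closed_segment (pos u) (pos v) \<longleftrightarrow> (\<exists>t. 0 \<le> t \<and> t \<le> 1 \<and> z = Complex (xseg u v t) (yseg u v t))"
proof -
  have "(1 - t) *\<^sub>R pos u + t *\<^sub>R pos v = Complex (xseg u v t) (yseg u v t)" for t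
    by (simp add: pos_def xseg_def yseg_def complex_eq_iff)
  then show ?thesis by (auto simp: closed_segment_def)
qed

lemma seg_ends: "Complex (xseg u v 0) (yseg u v 0) = pos u" "Complex (xseg u v 1) (yseg u v 1) = pos v"
  by (simp_all add: pos_def xseg_def yseg_def)

lemma pos_eq_iff: "pos u = pos v \<longleftrightarrow> u = v"
  using pos_inj by (auto simp: pos_def)

lemma segment_cases:
  assumes "z \<in> closed_segment (pos u) (pos v)"
  obtains "z = pos u" | "z = pos v" | t where "0 < t" "t < 1" "z = Complex (xseg u v t) (yseg u v t)"
proof -
  obtain t where t: "0 \<le> t" "t \<le> 1" "z = Complex (xseg u v t) (yseg u v t)"
    using assms in_segment_pos by blast
  then show thesis
    using that(1,2) that(3)[of t] seg_ends[of u v] by (cases "t = 0"; cases "t = 1") simp_all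
qed

lemma segment_vertex:
  assumes "step u v" "pos w \<in> closed_segment (pos u) (pos v)"
  shows "w \<in> {u, v}"
  using assms(2)
proof (cases rule: segment_cases)
  case (3 t)
  then show ?thesis using seg_avoids_vertices[OF assms(1), of t w] by (simp add: pos_def)
qed (simp_all add: pos_eq_iff)

lemma segments_meet:
  assumes "step u v" "step u' v'" "{u, v} \<noteq> {u', v'}"
  shows "closed_segment (pos u) (pos v) \<inter> closed_segment (pos u') (pos v') \<subseteq> pos ` ({u, v} \<inter> {u', v'})"
proof
  fix z assume z: "z \<in> closed_segment (pos u) (pos v) \<inter> closed_segment (pos u') (pos v')"
  have vertex: "z \<in> pos ` ({u, v} \<inter> {u', v'})" if "z = pos w" for w
    using segment_vertex[OF assms(1), of w] segment_vertex[OF assms(2), of w] z that by blast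
  from z have "z \<in> closed_segment (pos u) (pos v)" by blast
  then show "z \<in> pos ` ({u, v} \<inter> {u', v'})"
  proof (cases rule: segment_cases)
    case (3 t)
    from z have "z \<in> closed_segment (pos u') (pos v')" by blast
    then show ?thesis
    proof (cases rule: segment_cases)
      case (3 t')
      then have "u = u' \<and> v = v'"
        using segs_disjoint[OF assms(1) \<open>0 < t\<close> \<open>t < 1\<close> assms(2), of t'] \<open>z = Complex (xseg u v t) _\<close> by simp
      then show ?thesis using assms(3) by simp
    qed (use vertex in auto)
  qed (use vertex in auto)
qed

lemma planar_bundled: "planar bundled"
proof -
  \<comment> \<open>Edges are unordered, so \<open>Min\<close> and \<open>Max\<close> choose a
    direction for the segment.\<close>
  define \<gamma> where "\<gamma> = (\<lambda>e :: nat set. linepath (pos (Min e)) (pos (Max e)))"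
  have \<gamma>: "path_image (\<gamma> {u, v}) = closed_segment (pos u) (pos v)"
    "{pathstart (\<gamma> {u, v}), pathfinish (\<gamma> {u, v})} = pos ` {u, v}" for u v
    by (auto simp: \<gamma>_def min_def max_def closed_segment_commute)
  have "plane_drawing bundled pos \<gamma>"
    unfolding plane_drawing_def
  proof (intro conjI ballI impI)
    show "inj_on pos (verts bundled)" by (simp add: inj_on_def pos_eq_iff)
    fix e assume "e \<in> edges bundled"
    then obtain u v where e: "step u v" "e = {u, v}" by (auto simp: bundled_def)
    show "arc (\<gamma> e)"
      using step_ne[OF e(1)] by (auto simp: \<gamma>_def e(2) min_def max_def pos_eq_iff)
    show "{pathstart (\<gamma> e), pathfinish (\<gamma> e)} = pos ` e"
      unfolding e(2) by (rule \<gamma>(2))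
    have "u < n" "v < n" using e(1) by (simp_all add: step_def valid_def)
    then show "path_image (\<gamma> e) \<inter> pos ` verts bundled = pos ` e"
      unfolding e(2) \<gamma>(1) using segment_vertex[OF e(1)] by (auto simp: bundled_def)
    fix e' assume "e' \<in> edges bundled" and ne: "e \<noteq> e'"
    then obtain u' v' where e': "step u' v'" "e' = {u', v'}" by (auto simp: bundled_def)
    show "path_image (\<gamma> e) \<inter> path_image (\<gamma> e') \<subseteq> pos ` (e \<inter> e')"
      using segments_meet[OF e(1) e'(1)] ne unfolding e(2) e'(2) \<gamma>(1) by blast
  qed
  then show ?thesis by (auto simp: planar_def)
qed

text \<open>The cycle that uses path number \<open>h t\<close> of bundle \<open>t\<close>; for a
  thick column \<open>c\<close> the bundle is \<open>c div 3\<close>. The formula inverts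
  \<open>col\<close> and \<open>level\<close>.\<close>

definition cyc :: "(nat \<Rightarrow> nat) \<Rightarrow> nat \<Rightarrow> nat" where
  "cyc h c = c + k * (if thick c then h (c div 3) else 0)"

definition cyc_copy :: "(nat \<Rightarrow> nat) \<Rightarrow> nat ugraph" where
  "cyc_copy h = (cyc h ` {..<k}, (\<lambda>e. cyc h ` e) ` edges (cycle_graph k))"

lemma col_cyc: "c < k \<Longrightarrow> col (cyc h c) = c"
  by (simp add: col_def cyc_def)

lemma level_cyc: "c < k \<Longrightarrow> level (cyc h c) = (if thick c then h (c div 3) else 0)"
  using k by (simp add: level_def cyc_def)

lemma cyc_inj: "inj_on (cyc h) {..<k}"
  by (rule inj_onI) (metis col_cyc lessThan_iff)

lemma thick_div: "thick c \<Longrightarrow> c div 3 < m"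
  by (auto simp: thick_def)

lemma thick_nxt_div:
  assumes "thick c" "thick (nxt c)"
  shows "nxt c div 3 = c div 3"
proof -
  have "nxt c = c + 1" using assms(2) by (auto simp: thick_def nxt_def split: if_splits)
  then have "c mod 3 \<noteq> 0" "(c + 1) mod 3 \<noteq> 0" using assms by (auto simp: thick_def)
  then have "(c + 1) div 3 = c div 3" by presburger
  then show ?thesis using \<open>nxt c = c + 1\<close> by simp
qed

lemma cyc_lt:
  assumes h: "h \<in> {..<m} \<rightarrow>\<^sub>E {..<n div k}" and c: "c < k"
  shows "cyc h c < n"
proof -
  let ?r = "if thick c then h (c div 3) else 0"
  \<comment> \<open>Since \<open>m \<ge> 1\<close>, the value \<open>h 0\<close> witnesses
    \<open>n div k \<ge> 1\<close>, which is what level 0 of a thin column needs.\<close>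
  have "h 0 < n div k" using PiE_mem[OF h, of 0] m(2) by simp
  moreover have "h (c div 3) < n div k" if "thick c"
    using PiE_mem[OF h, of "c div 3"] thick_div[OF that] by simp
  ultimately have "?r + 1 \<le> n div k"
    by (cases "thick c") simp_all
  then have "k * (?r + 1) \<le> k * (n div k)" by (rule mult_le_mono2)
  then have "cyc h c < k * (n div k)"
    using c unfolding cyc_def distrib_left by linarith
  also have "\<dots> \<le> n" by simp
  finally show ?thesis .
qed

lemma step_cyc:
  assumes h: "h \<in> {..<m} \<rightarrow>\<^sub>E {..<n div k}" and c: "c < k"
  shows "step (cyc h c) (cyc h (nxt c))"
  using c cyc_lt[OF h] nxt_lt[OF c] thick_nxt_div[of c]
  unfolding step_def valid_def by (simp add: col_cyc level_cyc)

lemma cyc_copy_in: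
  assumes h: "h \<in> {..<m} \<rightarrow>\<^sub>E {..<n div k}"
  shows "cyc_copy h \<in> copies (cycle_graph k) bundled"
proof -
  have E: "(\<lambda>e. cyc h ` e) ` edges (cycle_graph k) = (\<lambda>c. {cyc h c, cyc h (nxt c)}) ` {..<k}"
    unfolding edges_cycle_graph image_image by (intro image_cong) (simp_all add: nxt_eq_mod[symmetric])
  have edge: "{cyc h c, cyc h (nxt c)} \<in> edges bundled" if "c < k" for c
    using step_cyc[OF h that] by (simp add: edge_bundled)
  then have sub: "edges (cyc_copy h) \<subseteq> edges bundled"
    unfolding cyc_copy_def E by auto
  have "e \<subseteq> verts (cyc_copy h) \<and> card e = 2" if "e \<in> edges (cyc_copy h)" for e
  proof -
    obtain c where "c < k" "e = {cyc h c, cyc h (nxt c)}"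
      using \<open>e \<in> _\<close> unfolding cyc_copy_def E by auto
    moreover have "card e = 2" using sub that simple_bundled by (auto simp: simple_graph_def)
    ultimately show ?thesis using nxt_lt by (auto simp: cyc_copy_def)
  qed
  then have "simple_graph (cyc_copy h)"
    by (simp add: simple_graph_def) (simp add: cyc_copy_def)
  moreover have "verts (cyc_copy h) \<subseteq> verts bundled"
    using cyc_lt[OF h] by (auto simp: cyc_copy_def bundled_def)
  ultimately have "subgraph (cyc_copy h) bundled"
    using sub by (simp add: subgraph_def)
  moreover have "graph_iso (cycle_graph k) (cyc_copy h)"
    unfolding graph_iso_def
  proof (intro exI conjI)
    have "verts (cycle_graph k) = {..<k}" by (simp add: cycle_graph_def)
    then show "bij_betw (cyc h) (verts (cycle_graph k)) (verts (cyc_copy h))"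
      using cyc_inj by (simp add: bij_betw_def cyc_copy_def)
    show "(\<lambda>e. cyc h ` e) ` edges (cycle_graph k) = edges (cyc_copy h)"
      by (simp add: cyc_copy_def)
  qed
  ultimately show ?thesis by (simp add: copies_def)
qed

lemma cyc_copy_inj: "inj_on cyc_copy ({..<m} \<rightarrow>\<^sub>E {..<n div k})"
proof (rule inj_onI)
  fix h h' assume h: "h \<in> {..<m} \<rightarrow>\<^sub>E {..<n div k}" "h' \<in> {..<m} \<rightarrow>\<^sub>E {..<n div k}"
    and eq: "cyc_copy h = cyc_copy h'"
  have "h t = h' t" if t: "t < m" for t
  proof -
    \<comment> \<open>The vertex set alone determines \<open>h\<close>: the only vertex of the cycle
      in column \<open>3 * t + 1\<close> has level \<open>h t\<close>.\<close>
    let ?c = "3 * t + 1"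
    have c: "?c < k" "thick ?c" "?c div 3 = t"
      using t m by (auto simp: thick_def)
    have "cyc h ` {..<k} = cyc h' ` {..<k}" using eq by (simp add: cyc_copy_def)
    then obtain c' where c': "c' < k" "cyc h ?c = cyc h' c'"
      using c(1) by (metis imageE imageI lessThan_iff)
    then have "c' = ?c" using col_cyc[OF c(1), of h] col_cyc[OF c'(1), of h'] by simp
    then show ?thesis
      using c'(2) level_cyc[OF c(1), of h] level_cyc[OF c(1), of h'] c by simp
  qed
  then show "h = h'" using h by (intro PiE_ext) auto
qed

lemma card_copies_bundled: "(n div k) ^ m \<le> card (copies (cycle_graph k) bundled)"
proof -
  let ?H = "{..<m} \<rightarrow>\<^sub>E {..<n div k}"
  have "(n div k) ^ m = card ?H"
    by (simp add: card_PiE)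
  also have "\<dots> = card (cyc_copy ` ?H)"
    by (rule card_image[OF cyc_copy_inj, symmetric])
  also have "\<dots> \<le> card (copies (cycle_graph k) bundled)"
    using cyc_copy_in by (intro card_mono finite_copies) (auto simp: bundled_def)
  finally show ?thesis .
qed

lemma bundled_C4_free: "\<not> contains bundled (cycle_graph 4)"
proof
  assume "contains bundled (cycle_graph 4)"
  then obtain S where S: "edges S \<subseteq> edges bundled" "graph_iso (cycle_graph 4) S"
    by (auto simp: contains_def copies_def subgraph_def)
  have v: "verts (cycle_graph 4) = {..<4}" by (simp add: cycle_graph_def)
  obtain f where f: "inj_on f {..<4}" "(\<lambda>e. f ` e) ` edges (cycle_graph 4) = edges S"
    using S(2) unfolding graph_iso_def v bij_betw_def by blast
  have "{f 0, f 1} \<in> edges bundled" "{f 1, f 2} \<in> edges bundled" "{f 2, f 3} \<in> edges bundled" "{f 3, f 0} \<in> edges bundled"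
    using S(1) unfolding f(2)[symmetric] edges_C4 by simp_all
  then have "f 0 = f 2 \<or> f 1 = f 3"
    using no_C4[of "f 0" "f 1" "f 2" "f 3"] unfolding edge_bundled by blast
  then show False using f(1) by (auto dest: inj_onD)
qed

lemma bundled_in: "bundled \<in> planar_free_graphs n {cycle_graph 4}"
  using simple_bundled planar_bundled bundled_C4_free by (simp add: planar_free_graphs_def) (simp add: bundled_def)

lemma ex_planar_cycle_ge: "(n div k) ^ (k div 3) \<le> ex_planar n (cycle_graph k) {cycle_graph 4}"
proof -
  have "card (copies (cycle_graph k) bundled) \<le> ex_planar n (cycle_graph k) {cycle_graph 4}"
    unfolding ex_planar_def using bundled_in by (intro Max_ge finite_copies_counts) blast
  then show ?thesis using card_copies_bundled by (simp add: m_def)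
qed
end

theorem theorem2p9:
  fixes k :: nat
  assumes "k \<ge> 5"
  shows "(\<lambda>n. real (ex_planar n (cycle_graph k) {cycle_graph 4})) \<in> \<Theta>(\<lambda>n. real n ^ (k div 3))"
proof (rule bigthetaI)
  let ?ex = "\<lambda>n. ex_planar n (cycle_graph k) {cycle_graph 4}"
  show "(\<lambda>n. real (?ex n)) \<in> O(\<lambda>n. real n ^ (k div 3))"
  proof (rule bigoI)
    show "\<forall>\<^sub>F n in sequentially. norm (real (?ex n)) \<le> real (2 ^ k * (4 ^ 6) ^ k) * norm (real n ^ (k div 3))"
    proof (rule eventually_sequentiallyI)
      fix n :: nat assume "n \<ge> 1"
      from ex_planar_cycle_le[OF assms this]
      have "real (?ex n) \<le> real (2 ^ k * (4 ^ 6) ^ k * n ^ (k div 3))" by (rule of_nat_mono)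
      then show "norm (real (?ex n)) \<le> real (2 ^ k * (4 ^ 6) ^ k) * norm (real n ^ (k div 3))" by simp
    qed
  qed
  show "(\<lambda>n. real (?ex n)) \<in> \<Omega>(\<lambda>n. real n ^ (k div 3))"
  proof (rule landau_omega.bigI)
    show "(1 / (2 * real k)) ^ (k div 3) > 0" using assms by simp
    show "\<forall>\<^sub>F n in sequentially.
        (1 / (2 * real k)) ^ (k div 3) * norm (real n ^ (k div 3)) \<le> norm (real (?ex n))"
    proof (rule eventually_sequentiallyI)
      fix n assume n: "n \<ge> 2 * k"
      \<comment> \<open>The remainder is less than \<open>k\<close>, hence at most
        \<open>k * (n div k)\<close>, so rounding down costs at most a factor of two.\<close>
      have "n \<le> 2 * k * (n div k)"
      proof -
        have "n = k * (n div k) + n mod k" by simp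
        moreover have "n mod k < k" using assms by simp
        moreover have "k * 1 \<le> k * (n div k)"
          using n assms by (intro mult_le_mono2) (simp add: div_greater_zero_iff Suc_le_eq)
        ultimately show ?thesis by linarith
      qed
      then have "real n \<le> 2 * real k * real (n div k)"
        using of_nat_mono[where 'a = real] by fastforce
      then have "1 / (2 * real k) * real n \<le> real (n div k)"
        using assms by (simp add: field_simps)
      then have "(1 / (2 * real k) * real n) ^ (k div 3) \<le> real (n div k) ^ (k div 3)"
        by (intro power_mono) simp_all
      also have "\<dots> = real ((n div k) ^ (k div 3))" by simp
      also have "\<dots> \<le> real (?ex n)"
        using bundle_graph.ex_planar_cycle_ge[of k n] assms by (intro of_nat_mono) (simp add: bundle_graph_def)
      finally show "(1 / (2 * real k)) ^ (k div 3) * norm (real n ^ (k div 3)) \<le> norm (real (?ex n))"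
        by (simp add: power_mult_distrib power_divide)
    qed
  qed
qed

end
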